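(* Let $\mathcal R_0$ be an indecomposable admissible component of the root groupoid, $v\in\mathcal R_0$, and let $s_1,\dots,s_m$ be the reflections $s_i=s_{\alpha_i}$ with respect to the $v$-principal roots $\alpha_1,\dots,\alpha_m$. Then the Weyl group $W=W(v)$ is a Coxeter group generated by $s_1,\dots,s_m$ (that is, $(W,\{s_1,\dots,s_m\})$ is a Coxeter system). In the Coxeter relations $(s_is_j)^{m_{ij}}=1$ ($i\ne j$) the possible values of $m_{ij}$ are $2,3,4,6$ or $\infty$.
   Context: Root groupoid. Fix a finite set $X$. A root datum is a quadruple $v=(\mathfrak h,a,b,p)$ with $\mathfrak h$ a finite-dimensional complex vector space, $a:X\to\mathfrak h$, $b:X\to\mathfrak h^*$ such that the families $(a(x))_{x\in X}$ and $(b(x))_{x\in X}$ are linearly independent, and $p:X\to\mathbb Z_2$; we write $\mathfrak h(v),a_v,b_v,p_v$. Its Cartan matrix is $a_{xy}=\langle a(x),b(y)\rangle$. An element $x\in X$ is reflectable at $v$ if: $a_{xx}=0$ implies $p(x)=1$; if $a_{xx}\ne 0$ and $p(x)=0$ then $2a_{xy}/a_{xx}\in\mathbb Z_{\le 0}$ for all $y\ne x$; if $a_{xx}\neq 0$ and $p(x)=1$ then $a_{xy}/a_{xx}\in\mathbb Z_{\le 0}$ for all $y\ne x$. For $x$ reflectable at $v$ the reflexion $r_x:v\to v'=(\mathfrak h,a',b',p')$ is defined as follows. Anisotropic case $a_{xx}\ne0$: $p'=p$, $a'(y)=a(y)-2\frac{a_{yx}}{a_{xx}}a(x)$, $b'(y)=b(y)-2\frac{a_{xy}}{a_{xx}}b(x)$.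 Isotropic case $a_{xx}=0$: $(a'(x),b'(x),p'(x))=(-a(x),-b(x),p(x))$; for $y\neq x$ with $a_{xy}=0$, $(a'(y),b'(y),p'(y))=(a(y),b(y),p(y))$; for $y$ with $a_{xy}\ne0$, $(a'(y),b'(y),p'(y))=(a(y)+\frac{a_{yx}}{a_{xy}}a(x),\,b(y)+b(x),\,1+p(y))$. The root groupoid $\mathcal R$ has the root data as objects; its arrows are generated by reflexions, tautological arrows $t_\theta:(\mathfrak h,a,b,p)\to(\mathfrak h',\theta\circ a,(\theta^* )^{-1}\circ b,p)$ for linear isomorphisms $\theta:\mathfrak h\to\mathfrak h'$, and homotheties $h_\lambda:(\mathfrak h,a,b,p)\to(\mathfrak h,\lambda a,b,p)$ for $\lambda:X\to\mathbb C^*$. Each generator induces a linear isomorphism of the spaces $\mathfrak h$ (the identity for reflexions and homotheties, $\theta$ for $t_\theta$), and two compositions of generators $v\to v'$ are identified iff they induce the same isomorphism $\mathfrak h(v)\to\mathfrak h(v')$. A component is a connected component of $\mathcal R$; it is indecomposable if for $v$ in it there is no partition $X=X_1\sqcup X_2$ into nonempty subsets with $a_{xy}=a_{yx}=0$ for $x\in X_1,y\in X_2$. Admissibility. The half-baked Lie superalgebra $\tilde{\mathfrak g}(v)$ is generated by $\mathfrak h(v)$ (even) and $\tilde e_x,\tilde f_x$ ($x\in X$, of parity $p(x)$) with relations $[\mathfrak h,\mathfrak h]=0$, $[h,\tilde e_x]=\langle b(x),h\rangle\tilde e_x$, $[h,\tilde f_x]=-\langle b(x),h\rangle\tilde f_x$,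 $[\tilde e_x,\tilde f_y]=0$ for $x\ne y$, $[\tilde e_x,\tilde f_x]=a(x)$. A component $\mathcal R_0$ is admissible if there is a collection of quotients $\mathfrak g(v)=\tilde{\mathfrak g}(v)/I(v)$, $v\in\mathcal R_0$, with $I(v)\cap\mathfrak h(v)=0$, such that for each arrow $v\to v'$ in $\mathcal R_0$ the induced isomorphism $\mathfrak h(v)\to\mathfrak h(v')$ extends to an isomorphism $\mathfrak g(v)\to\mathfrak g(v')$ (a root algebra). Equivalently: at every $v\in\mathcal R_0$, if $x$ is reflectable at $v$ and $a_{xy}=0$ then $a_{yx}=0$. Skeleton and Weyl group. $\mathrm{Sk}(v)$ is the set of objects obtained from $v$ by chains of reflexions, $\mathrm{Sp}(v)\subset\mathrm{Sk}(v)$ those obtained by chains of isotropic reflexions; all these objects have the same $\mathfrak h=\mathfrak h(v)$. Real roots: $\Delta^{re}=\{b_u(x):u\in\mathrm{Sk}(v),x\in X\}\subset\mathfrak h^*$. A real root $\alpha$ is anisotropic if $\alpha=b_u(x)$ with $u\in\mathrm{Sk}(v)$, $x$ reflectable at $u$ and $a_{xx}\neq0$ at $u$; then $\alpha^\vee=2a_u(x)/a_{xx}\in\mathfrak h$ (in an admissible component this is independent of the choice of $u,x$), and $s_\alpha(h)=h-\langle\alpha,h\rangle\alpha^\vee$ on $\mathfrak h$. The Weyl group $W(v)\subset GL(\mathfrak h)$ is generated by $s_\alpha$ for all anisotropic real roots $\alpha$. An anisotropic real root $\alpha$ is $v$-principal if $\alpha=b_{v'}(x)$ for some $v'\in\mathrm{Sp}(v)$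 and $x\in X$. *)

theory Defs
  imports
    Complex_Main
    "HOL-Library.Z2"
    "HOL-Library.Extended_Nat"
    "HOL-Library.Nonpos_Ints"
    "HOL-Library.Poly_Mapping"
    "HOL-Algebra.Multiplicative_Group"
    "HOL-Algebra.Generated_Groups"
begin

section \<open>Finite-dimensional complex vector spaces\<close>

class complex_vector = ab_group_add +
  fixes scaleC :: "complex \<Rightarrow> 'a \<Rightarrow> 'a"  (infixr \<open>*\<^sub>C\<close> 75)
  assumes scaleC_add_right: "c *\<^sub>C (u + w) = c *\<^sub>C u + c *\<^sub>C w"
    and scaleC_add_left: "(c + d) *\<^sub>C u = c *\<^sub>C u + d *\<^sub>C u"
    and scaleC_scaleC: "c *\<^sub>C (d *\<^sub>C u) = (c * d) *\<^sub>C u"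
    and scaleC_one: "1 *\<^sub>C u = u"

global_interpretation cvec: vector_space "scaleC :: complex \<Rightarrow> 'a \<Rightarrow> 'a::complex_vector"
  by unfold_locales (fact scaleC_add_right scaleC_add_left scaleC_scaleC scaleC_one)+

class fin_dim_complex_vector = complex_vector +
  assumes finite_spanning_set: "\<exists>B. finite B \<and> (\<forall>u. \<exists>c. u = (\<Sum>b\<in>B. c b *\<^sub>C b))"

abbreviation clinear :: "('a::complex_vector \<Rightarrow> 'b::complex_vector) \<Rightarrow> bool"
  where "clinear \<equiv> Vector_Spaces.linear scaleC scaleC"

abbreviation cfunctional :: "('a::complex_vector \<Rightarrow> complex) \<Rightarrow> bool"
  where "cfunctional \<equiv> Vector_Spaces.linear scaleC (*)"


section \<open>Root data\<close>

text \<open>The set \<open>X\<close> is the finite type \<open>'x\<close>, the space \<open>\<hh>\<close> is the type \<open>'h\<close>, and elements of the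
  dual of \<open>\<hh>\<close> are linear functions \<open>'h \<Rightarrow> complex\<close>. The fields \<open>coroot_a\<close>, \<open>root_b\<close>, \<open>parity\<close> are the families
  \<open>a\<close>, \<open>b\<close>, \<open>p\<close>.\<close>

record ('x, 'h) root_datum =
  coroot_a :: "'x \<Rightarrow> 'h"
  root_b :: "'x \<Rightarrow> 'h \<Rightarrow> complex"
  parity :: "'x \<Rightarrow> bit"

definition valid_root_datum ::
    "('x::finite, 'h::fin_dim_complex_vector) root_datum \<Rightarrow> bool"
  where "valid_root_datum v \<longleftrightarrow>
    (\<forall>x. cfunctional (root_b v x)) \<and>
    (\<forall>c. (\<Sum>x\<in>UNIV. c x *\<^sub>C coroot_a v x) = 0 \<longrightarrow> (\<forall>x. c x = 0)) \<and>
    (\<forall>c. (\<forall>h. (\<Sum>x\<in>UNIV. c x * root_b v x h) = 0) \<longrightarrow> (\<forall>x. c x = 0))"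

definition cartan :: "('x, 'h) root_datum \<Rightarrow> 'x \<Rightarrow> 'x \<Rightarrow> complex"
  where "cartan v x y = root_b v y (coroot_a v x)"

definition reflectable :: "('x, 'h) root_datum \<Rightarrow> 'x \<Rightarrow> bool"
  where "reflectable v x \<longleftrightarrow>
    (cartan v x x = 0 \<longrightarrow> parity v x = 1) \<and>
    (cartan v x x \<noteq> 0 \<and> parity v x = 0 \<longrightarrow>
       (\<forall>y. y \<noteq> x \<longrightarrow> 2 * cartan v x y / cartan v x x \<in> \<int>\<^sub>\<le>\<^sub>0)) \<and>
    (cartan v x x \<noteq> 0 \<and> parity v x = 1 \<longrightarrow>
       (\<forall>y. y \<noteq> x \<longrightarrow> cartan v x y / cartan v x x \<in> \<int>\<^sub>\<le>\<^sub>0))"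

definition anisotropic_reflexion ::
    "'x \<Rightarrow> ('x, 'h::complex_vector) root_datum \<Rightarrow> ('x, 'h) root_datum"
  where "anisotropic_reflexion x v =
    \<lparr>coroot_a = \<lambda>y. coroot_a v y - (2 * cartan v y x / cartan v x x) *\<^sub>C coroot_a v x,
     root_b = \<lambda>y h. root_b v y h - 2 * cartan v x y / cartan v x x * root_b v x h,
     parity = parity v\<rparr>"

definition isotropic_reflexion ::
    "'x \<Rightarrow> ('x, 'h::complex_vector) root_datum \<Rightarrow> ('x, 'h) root_datum"
  where "isotropic_reflexion x v =
    \<lparr>coroot_a = \<lambda>y. if y = x then - coroot_a v x
               else if cartan v x y = 0 then coroot_a v y
               else coroot_a v y + (cartan v y x / cartan v x y) *\<^sub>C coroot_a v x,
     root_b = \<lambda>y h. if y = x then - root_b v x h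
               else if cartan v x y = 0 then root_b v y h
               else root_b v y h + root_b v x h,
     parity = \<lambda>y. if y = x then parity v x
               else if cartan v x y = 0 then parity v y
               else 1 + parity v y\<rparr>"

definition reflexion ::
    "'x \<Rightarrow> ('x, 'h::complex_vector) root_datum \<Rightarrow> ('x, 'h) root_datum"
  where "reflexion x v =
    (if cartan v x x = 0 then isotropic_reflexion x v else anisotropic_reflexion x v)"


section \<open>The root groupoid\<close>

definition tautological ::
    "('h \<Rightarrow> 'h) \<Rightarrow> ('x, 'h) root_datum \<Rightarrow> ('x, 'h) root_datum"
  where "tautological \<theta> v = \<lparr>coroot_a = \<theta> \<circ> coroot_a v, root_b = \<lambda>x. root_b v x \<circ> inv_into UNIV \<theta>, parity = parity v\<rparr>"

definition homothety ::
    "('x \<Rightarrow> complex) \<Rightarrow> ('x, 'h::complex_vector) root_datum \<Rightarrow> ('x, 'h) root_datum"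
  where "homothety l v = \<lparr>coroot_a = \<lambda>x. l x *\<^sub>C coroot_a v x, root_b = root_b v, parity = parity v\<rparr>"

text \<open>Compositions of generators with the same source and target are identified iff they induce
  the same isomorphism, so an arrow is a triple consisting of its source, the induced isomorphism
  and its target. Spaces joined by arrows are isomorphic; all of them are identified with \<open>'h\<close>, and
  the tautological arrows are given by the linear automorphisms of \<open>'h\<close>.\<close>

inductive arrow ::
    "('x::finite, 'h::fin_dim_complex_vector) root_datum \<Rightarrow> ('h \<Rightarrow> 'h) \<Rightarrow> ('x, 'h) root_datum \<Rightarrow> bool"
  where
    arrow_id: "valid_root_datum v \<Longrightarrow> arrow v id v"
  | arrow_reflexion: "valid_root_datum v \<Longrightarrow> reflectable v x \<Longrightarrow> arrow v id (reflexion x v)"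
  | arrow_tautological:
      "valid_root_datum v \<Longrightarrow> clinear \<theta> \<Longrightarrow> bij \<theta> \<Longrightarrow> arrow v \<theta> (tautological \<theta> v)"
  | arrow_homothety:
      "valid_root_datum v \<Longrightarrow> (\<And>x. l x \<noteq> 0) \<Longrightarrow> arrow v id (homothety l v)"
  | arrow_inverse: "arrow v \<theta> v' \<Longrightarrow> arrow v' (inv_into UNIV \<theta>) v"
  | arrow_compose: "arrow v \<theta> v' \<Longrightarrow> arrow v' \<eta> v'' \<Longrightarrow> arrow v (\<eta> \<circ> \<theta>) v''"

definition component :: "('x::finite, 'h::fin_dim_complex_vector) root_datum set \<Rightarrow> bool"
  where "component R \<longleftrightarrow> (\<exists>v. valid_root_datum v \<and> R = {v'. \<exists>\<theta>. arrow v \<theta> v'})"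

definition indecomposable :: "('x, 'h) root_datum set \<Rightarrow> bool"
  where "indecomposable R \<longleftrightarrow>
    (\<forall>v\<in>R. \<not> (\<exists>X\<^sub>1 X\<^sub>2. X\<^sub>1 \<noteq> {} \<and> X\<^sub>2 \<noteq> {} \<and> X\<^sub>1 \<inter> X\<^sub>2 = {} \<and> X\<^sub>1 \<union> X\<^sub>2 = UNIV \<and>
       (\<forall>x\<in>X\<^sub>1. \<forall>y\<in>X\<^sub>2. cartan v x y = 0 \<and> cartan v y x = 0)))"


section \<open>Half-baked Lie superalgebras and admissibility\<close>

text \<open>The half-baked Lie superalgebra of \<open>v\<close> is the free nonassociative complex algebra on the
  generators below, modulo the ideal generated by the Lie superalgebra identities and the defining
  relations.\<close>

datatype ('x, 'h) generator = Cart 'h | RootE 'x | RootF 'x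

datatype ('x, 'h) monomial =
  Gen "('x, 'h) generator" | Br "('x, 'h) monomial" "('x, 'h) monomial"

type_synonym ('x, 'h) free_algebra = "('x, 'h) monomial \<Rightarrow>\<^sub>0 complex"

definition fscale :: "complex \<Rightarrow> ('x, 'h) free_algebra \<Rightarrow> ('x, 'h) free_algebra"
  where "fscale c u = Poly_Mapping.map ((*) c) u"

definition fbracket ::
    "('x, 'h) free_algebra \<Rightarrow> ('x, 'h) free_algebra \<Rightarrow> ('x, 'h) free_algebra"
  where "fbracket u w = (\<Sum>s\<in>Poly_Mapping.keys u. \<Sum>t\<in>Poly_Mapping.keys w.
    Poly_Mapping.single (Br s t) (Poly_Mapping.lookup u s * Poly_Mapping.lookup w t))"

definition gen_h :: "'h \<Rightarrow> ('x, 'h) free_algebra"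
  where "gen_h h = Poly_Mapping.single (Gen (Cart h)) 1"

definition gen_e :: "'x \<Rightarrow> ('x, 'h) free_algebra"
  where "gen_e x = Poly_Mapping.single (Gen (RootE x)) 1"

definition gen_f :: "'x \<Rightarrow> ('x, 'h) free_algebra"
  where "gen_f x = Poly_Mapping.single (Gen (RootF x)) 1"

fun generator_parity :: "('x, 'h) root_datum \<Rightarrow> ('x, 'h) generator \<Rightarrow> bit"
  where
    "generator_parity v (Cart h) = 0"
  | "generator_parity v (RootE x) = parity v x"
  | "generator_parity v (RootF x) = parity v x"

fun monomial_parity :: "('x, 'h) root_datum \<Rightarrow> ('x, 'h) monomial \<Rightarrow> bit"
  where
    "monomial_parity v (Gen g) = generator_parity v g"
  | "monomial_parity v (Br s t) = monomial_parity v s + monomial_parity v t"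

definition homogeneous :: "('x, 'h) root_datum \<Rightarrow> bit \<Rightarrow> ('x, 'h) free_algebra set"
  where "homogeneous v \<epsilon> = {u. \<forall>t\<in>Poly_Mapping.keys u. monomial_parity v t = \<epsilon>}"

definition superideal :: "('x, 'h) root_datum \<Rightarrow> ('x, 'h) free_algebra set \<Rightarrow> bool"
  where "superideal v K \<longleftrightarrow>
    0 \<in> K \<and>
    (\<forall>u\<in>K. \<forall>w\<in>K. u + w \<in> K) \<and>
    (\<forall>c. \<forall>u\<in>K. fscale c u \<in> K) \<and>
    (\<forall>u\<in>K. \<forall>w. fbracket u w \<in> K \<and> fbracket w u \<in> K) \<and>
    (\<forall>u\<^sub>0\<in>homogeneous v 0. \<forall>u\<^sub>1\<in>homogeneous v 1. u\<^sub>0 + u\<^sub>1 \<in> K \<longrightarrow> u\<^sub>0 \<in> K \<and> u\<^sub>1 \<in> K)"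

definition koszul :: "bit \<Rightarrow> bit \<Rightarrow> complex"
  where "koszul \<epsilon> \<eta> = (if \<epsilon> = 1 \<and> \<eta> = 1 then - 1 else 1)"

inductive_set relators ::
    "('x, 'h::complex_vector) root_datum \<Rightarrow> ('x, 'h) free_algebra set"
  for v :: "('x, 'h) root_datum"
  where
    super_antisymmetry:
      "u \<in> homogeneous v \<epsilon> \<Longrightarrow> w \<in> homogeneous v \<eta> \<Longrightarrow>
       fbracket u w + fscale (koszul \<epsilon> \<eta>) (fbracket w u) \<in> relators v"
  | super_jacobi:
      "u \<in> homogeneous v \<epsilon> \<Longrightarrow> w \<in> homogeneous v \<eta> \<Longrightarrow> z \<in> homogeneous v \<zeta> \<Longrightarrow>
       fbracket u (fbracket w z) - fbracket (fbracket u w) z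
         - fscale (koszul \<epsilon> \<eta>) (fbracket w (fbracket u z)) \<in> relators v"
  | H_add: "gen_h (h + k) - (gen_h h + gen_h k) \<in> relators v"
  | H_scale: "gen_h (c *\<^sub>C h) - fscale c (gen_h h) \<in> relators v"
  | H_H: "fbracket (gen_h h) (gen_h k) \<in> relators v"
  | H_E: "fbracket (gen_h h) (gen_e x) - fscale (root_b v x h) (gen_e x) \<in> relators v"
  | H_F: "fbracket (gen_h h) (gen_f x) + fscale (root_b v x h) (gen_f x) \<in> relators v"
  | E_F_distinct: "x \<noteq> y \<Longrightarrow> fbracket (gen_e x) (gen_f y) \<in> relators v"
  | E_F_same: "fbracket (gen_e x) (gen_f x) - gen_h (coroot_a v x) \<in> relators v"

definition half_baked_ideal ::
    "('x, 'h::complex_vector) root_datum \<Rightarrow> ('x, 'h) free_algebra set"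
  where "half_baked_ideal v = \<Inter>{K. superideal v K \<and> relators v \<subseteq> K}"

text \<open>An ideal \<open>I(v)\<close> of the half-baked algebra is represented by its preimage \<open>K\<close> in the free
  algebra, i.e. by an ideal containing \<^term>\<open>half_baked_ideal v\<close>; then \<open>\<gg>(v)\<close> is the free algebra
  modulo \<open>K\<close>.\<close>

definition half_baked_quotient ::
    "('x, 'h::complex_vector) root_datum \<Rightarrow> ('x, 'h) free_algebra set \<Rightarrow> bool"
  where "half_baked_quotient v K \<longleftrightarrow>
    superideal v K \<and> half_baked_ideal v \<subseteq> K \<and> (\<forall>h. gen_h h \<in> K \<longrightarrow> h = 0)"

definition cls :: "('x, 'h) free_algebra set \<Rightarrow> ('x, 'h) free_algebra \<Rightarrow> ('x, 'h) free_algebra set"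
  where "cls K u = {w. w - u \<in> K}"

definition quotient_isomorphism ::
    "('x, 'h) root_datum \<Rightarrow> ('x, 'h) free_algebra set \<Rightarrow>
     ('x, 'h) root_datum \<Rightarrow> ('x, 'h) free_algebra set \<Rightarrow>
     (('x, 'h) free_algebra set \<Rightarrow> ('x, 'h) free_algebra set) \<Rightarrow> bool"
  where "quotient_isomorphism v K v' K' \<phi> \<longleftrightarrow>
    bij_betw \<phi> (range (cls K)) (range (cls K')) \<and>
    (\<forall>u w u' w'. \<phi> (cls K u) = cls K' u' \<and> \<phi> (cls K w) = cls K' w' \<longrightarrow>
       \<phi> (cls K (u + w)) = cls K' (u' + w') \<and>
       (\<forall>c. \<phi> (cls K (fscale c u)) = cls K' (fscale c u')) \<and>
       \<phi> (cls K (fbracket u w)) = cls K' (fbracket u' w')) \<and>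
    (\<forall>\<epsilon>. \<forall>u\<in>homogeneous v \<epsilon>. \<exists>u'\<in>homogeneous v' \<epsilon>. \<phi> (cls K u) = cls K' u')"

definition admissible :: "('x::finite, 'h::fin_dim_complex_vector) root_datum set \<Rightarrow> bool"
  where "admissible R \<longleftrightarrow>
    (\<exists>K. (\<forall>v\<in>R. half_baked_quotient v (K v)) \<and>
         (\<forall>v\<in>R. \<forall>v'\<in>R. \<forall>\<theta>. arrow v \<theta> v' \<longrightarrow>
            (\<exists>\<phi>. quotient_isomorphism v (K v) v' (K v') \<phi> \<and>
                 (\<forall>h. \<phi> (cls (K v) (gen_h h)) = cls (K v') (gen_h (\<theta> h))))))"


section \<open>Skeleton, real roots and the Weyl group\<close>

definition skeleton ::
    "('x, 'h::complex_vector) root_datum \<Rightarrow> ('x, 'h) root_datum set"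
  where "skeleton v = {u. (\<lambda>u u'. \<exists>x. reflectable u x \<and> u' = reflexion x u)\<^sup>*\<^sup>* v u}"

definition spine ::
    "('x, 'h::complex_vector) root_datum \<Rightarrow> ('x, 'h) root_datum set"
  where "spine v =
    {u. (\<lambda>u u'. \<exists>x. reflectable u x \<and> cartan u x x = 0 \<and> u' = reflexion x u)\<^sup>*\<^sup>* v u}"

definition real_roots :: "('x, 'h::complex_vector) root_datum \<Rightarrow> ('h \<Rightarrow> complex) set"
  where "real_roots v = {root_b u x | u x. u \<in> skeleton v}"

definition anisotropic_roots :: "('x, 'h::complex_vector) root_datum \<Rightarrow> ('h \<Rightarrow> complex) set"
  where "anisotropic_roots v = {\<alpha> \<in> real_roots v.
    \<exists>u\<in>skeleton v. \<exists>x. reflectable u x \<and> cartan u x x \<noteq> 0 \<and> \<alpha> = root_b u x}"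

text \<open>The coroot is determined by \<open>\<alpha>\<close> only in admissible components.\<close>

definition coroot :: "('x, 'h::complex_vector) root_datum \<Rightarrow> ('h \<Rightarrow> complex) \<Rightarrow> 'h"
  where "coroot v \<alpha> = (THE c. \<exists>u\<in>skeleton v. \<exists>x. reflectable u x \<and> cartan u x x \<noteq> 0 \<and>
    \<alpha> = root_b u x \<and> c = (2 / cartan u x x) *\<^sub>C coroot_a u x)"

definition root_reflection :: "('x, 'h::complex_vector) root_datum \<Rightarrow> ('h \<Rightarrow> complex) \<Rightarrow> 'h \<Rightarrow> 'h"
  where "root_reflection v \<alpha> h = h - \<alpha> h *\<^sub>C coroot v \<alpha>"

definition principal_roots :: "('x, 'h::complex_vector) root_datum \<Rightarrow> ('h \<Rightarrow> complex) set"
  where "principal_roots v = {\<alpha> \<in> anisotropic_roots v. \<exists>u\<in>spine v. \<exists>x. \<alpha> = root_b u x}"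

definition GL :: "('h::complex_vector \<Rightarrow> 'h) monoid"
  where "GL = \<lparr>carrier = {g. clinear g \<and> bij g}, monoid.mult = (\<circ>), one = id\<rparr>"

definition weyl_group :: "('x, 'h::complex_vector) root_datum \<Rightarrow> ('h \<Rightarrow> 'h) monoid"
  where "weyl_group v = GL\<lparr>carrier := generate GL (root_reflection v ` anisotropic_roots v)\<rparr>"


section \<open>Coxeter systems\<close>

definition coxeter_exponent :: "('g, 'm) monoid_scheme \<Rightarrow> 'g \<Rightarrow> 'g \<Rightarrow> enat"
  where "coxeter_exponent G s t =
    (let n = group.ord G (s \<otimes>\<^bsub>G\<^esub> t) in if n = 0 then \<infinity> else enat n)"

definition word_value :: "('g, 'm) monoid_scheme \<Rightarrow> 'g list \<Rightarrow> 'g"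
  where "word_value G ws = foldr (\<lambda>s g. s \<otimes>\<^bsub>G\<^esub> g) ws \<one>\<^bsub>G\<^esub>"

text \<open>Equality of words in the group presented by the generators \<open>S\<close> and the relations
  \<open>(st)\<^bsup>m(s,t)\<^esup> = 1\<close> for \<open>m(s,t) < \<infinity>\<close>. For \<open>s = t\<close> these contain \<open>s\<^sup>2 = 1\<close>, since \<open>m(s,s) = 1\<close>;
  hence formal inverses of generators are not needed.\<close>

inductive coxeter_word_eq :: "('g, 'm) monoid_scheme \<Rightarrow> 'g set \<Rightarrow> 'g list \<Rightarrow> 'g list \<Rightarrow> bool"
  for G :: "('g, 'm) monoid_scheme" and S :: "'g set"
  where
    cw_refl: "coxeter_word_eq G S ws ws"
  | cw_sym: "coxeter_word_eq G S ws ws' \<Longrightarrow> coxeter_word_eq G S ws' ws"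
  | cw_trans:
      "coxeter_word_eq G S ws ws' \<Longrightarrow> coxeter_word_eq G S ws' ws'' \<Longrightarrow> coxeter_word_eq G S ws ws''"
  | cw_relation:
      "s \<in> S \<Longrightarrow> t \<in> S \<Longrightarrow> coxeter_exponent G s t = enat n \<Longrightarrow>
       coxeter_word_eq G S (us @ concat (replicate n [s, t]) @ vs) (us @ vs)"

definition coxeter_system :: "('g, 'm) monoid_scheme \<Rightarrow> 'g set \<Rightarrow> bool"
  where "coxeter_system G S \<longleftrightarrow>
    group G \<and> S \<subseteq> carrier G \<and> generate G S = carrier G \<and>
    (\<forall>s\<in>S. s \<noteq> \<one>\<^bsub>G\<^esub> \<and> s \<otimes>\<^bsub>G\<^esub> s = \<one>\<^bsub>G\<^esub>) \<and>
    (\<forall>ws\<in>lists S. \<forall>ws'\<in>lists S. word_value G ws = word_value G ws' \<longleftrightarrow> coxeter_word_eq G S ws ws')"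

end

theory Submission
  imports Defs
begin

text \<open>Let \<open>u\<close>, \<open>u'\<close> be in the skeleton of \<open>v\<close>. The isomorphism \<open>\<gg>(u) \<rightarrow> \<gg>(u')\<close> fixes \<open>\<hh>\<close>, so it maps
  weight spaces to weight spaces. By the triangular decomposition the weights of \<open>\<gg>(u')\<close> are integral
  combinations of the \<open>b\<^sub>u\<^sub>'(y)\<close> with coefficients of one sign, and the weight spaces of \<open>\<plusminus>b\<^sub>u\<^sub>'(y)\<close> are spanned by the
  generators. Hence every \<open>b\<^sub>u(x)\<close> is positive or negative at \<open>u'\<close>, and \<open>b\<^sub>u(x) = b\<^sub>u\<^sub>'(y)\<close> forces \<open>a\<^sub>u(x)\<close> and \<open>a\<^sub>u\<^sub>'(y)\<close> to be
  proportional. The rest uses only these two facts.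

  An anisotropic reflexion of \<open>u\<close> is the tautological arrow of \<open>s\<^sub>\<alpha>\<close>, so \<open>W\<close> acts on the skeleton, and the
  subgroup generated by the principal reflections maps the spine onto the whole skeleton; therefore it is \<open>W\<close>.
  An isotropic reflexion changes the sign of isotropic roots only, so the set of positive anisotropic
  roots is constant on the spine, and a principal reflection changes the sign of exactly one
  of them. This is what is needed for the Coxeter relations. The exponents are read off
  from the Cartan integers \<open>-a\<close>, \<open>-b\<close> of two principal roots: \<open>s\<^sub>\<alpha>s\<^sub>\<beta>\<close> has order 2, 3, 4, 6 for \<open>ab = 0, 1, 2, 3\<close> and
  infinite order for \<open>ab \<ge> 4\<close>.\<close>

section \<open>Coxeter systems from half-spaces\<close>

text \<open>Principal roots come from different objects of the spine, so they need not belong to one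
  base and need not be linearly independent. Half-spaces ask only for a notion of positive root, and
  independence is proved only for pairs. For the same reason the integrality and the sign of a
  Cartan integer are read off at two different objects, one for each of the two roots. Of the ideal
  only its trivial intersection with the Cartan part is known, so no basis of the algebra is at
  hand. The triangular decomposition is needed only as a spanning statement: weights are separated
  because the b(x) are linearly independent, and generators survive in the quotient because
  [e_x, f_x] = a(x) does. Coroots and pairings are complex a priori. Integers arise by comparing two
  integral expansions of roots, whose coefficients are unique.\<close>

primrec alternating :: "'a \<Rightarrow> 'a \<Rightarrow> nat \<Rightarrow> 'a list"
  where
    "alternating s t 0 = []"
  | "alternating s t (Suc n) = s # alternating t s n"

lemma length_alternating [simp]: "length (alternating s t n) = n"
  by (induction n arbitrary: s t) auto

lemma set_alternating: "set (alternating s t n) \<subseteq> {s, t}"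
  by (induction n arbitrary: s t) fastforce+

lemma take_alternating: "i \<le> n \<Longrightarrow> take i (alternating s t n) = alternating s t i"
proof (induction n arbitrary: i s t)
  case (Suc n)
  then show ?case by (cases i) auto
qed simp

lemma Cons_concat_replicate:
  "s # concat (replicate n [t, s]) = concat (replicate n [s, t]) @ [s]"
  by (induction n) auto

lemma coxeter_word_eq_context:
  "coxeter_word_eq G S us vs \<Longrightarrow> coxeter_word_eq G S (xs @ us @ ys) (xs @ vs @ ys)"
proof (induction rule: coxeter_word_eq.induct)
  case (cw_relation s t n us vs)
  then show ?case
    using coxeter_word_eq.cw_relation[of s S t G n "xs @ us" "vs @ ys"] by simp
qed (blast intro: coxeter_word_eq.intros)+

lemma coxeter_word_eq_append:
  "coxeter_word_eq G S us vs \<Longrightarrow> coxeter_word_eq G S (us @ ys) (vs @ ys)"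
  using coxeter_word_eq_context[where xs = "[]"] by fastforce

lemma coxeter_word_eq_Cons:
  "coxeter_word_eq G S us vs \<Longrightarrow> coxeter_word_eq G S (x # us) (x # vs)"
  using coxeter_word_eq_context[where xs = "[x]" and ys = "[]"] by fastforce

lemma word_value_simps [simp]:
  "word_value G [] = \<one>\<^bsub>G\<^esub>" "word_value G (s # ws) = s \<otimes>\<^bsub>G\<^esub> word_value G ws"
  by (simp_all add: word_value_def)

text \<open>The criterion of Bourbaki, Lie IV.1.7, Proposition 6: \<open>P s\<close> plays the role of the half-space
  of the elements \<open>w\<close> with \<open>w\<^sup>-\<^sup>1\<close> sending the root of \<open>s\<close> to a positive root.\<close>

locale half_spaces = group G for G (structure) +
  fixes S :: "'a set" and P :: "'a \<Rightarrow> 'a set"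
  assumes S_carrier: "S \<subseteq> carrier G"
    and generate_S: "generate G S = carrier G"
    and S_neq_one: "s \<in> S \<Longrightarrow> s \<noteq> \<one>"
    and S_square: "s \<in> S \<Longrightarrow> s \<otimes> s = \<one>"
    and one_in_P: "s \<in> S \<Longrightarrow> \<one> \<in> P s"
    and P_disjoint: "s \<in> S \<Longrightarrow> w \<in> carrier G \<Longrightarrow> w \<in> P s \<Longrightarrow> s \<otimes> w \<notin> P s"
    and P_wall: "s \<in> S \<Longrightarrow> t \<in> S \<Longrightarrow> w \<in> carrier G \<Longrightarrow> w \<in> P s \<Longrightarrow> w \<otimes> t \<notin> P s \<Longrightarrow> s \<otimes> w = w \<otimes> t"
begin

abbreviation val :: "'a list \<Rightarrow> 'a" where "val \<equiv> word_value G"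
abbreviation weq :: "'a list \<Rightarrow> 'a list \<Rightarrow> bool" (infix \<open>\<approx>\<close> 50) where "weq \<equiv> coxeter_word_eq G S"

lemma S_closed [intro]: "s \<in> S \<Longrightarrow> s \<in> carrier G"
  using S_carrier by blast

lemma val_closed [simp]: "set ws \<subseteq> S \<Longrightarrow> val ws \<in> carrier G"
  by (induction ws) auto

lemma val_append: "set us \<subseteq> S \<Longrightarrow> set vs \<subseteq> S \<Longrightarrow> val (us @ vs) = val us \<otimes> val vs"
  by (induction us) (auto simp: m_assoc S_closed)

lemma S_cancel [simp]: "s \<in> S \<Longrightarrow> g \<in> carrier G \<Longrightarrow> s \<otimes> (s \<otimes> g) = g"
  by (metis S_closed S_square l_one m_assoc)

section \<open>Reduced words and the exchange condition\<close>

definition reduced :: "'a list \<Rightarrow> bool"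
  where "reduced ws \<longleftrightarrow> set ws \<subseteq> S \<and> (\<forall>us. set us \<subseteq> S \<longrightarrow> val us = val ws \<longrightarrow> length ws \<le> length us)"

lemma reduced_exists:
  assumes "set ws \<subseteq> S"
  obtains us where "reduced us" "val us = val ws" "length us \<le> length ws"
proof -
  obtain us where us: "set us \<subseteq> S \<and> val us = val ws"
    and least: "\<forall>vs. set vs \<subseteq> S \<and> val vs = val ws \<longrightarrow> length us \<le> length vs"
    using ex_has_least_nat[of "\<lambda>us. set us \<subseteq> S \<and> val us = val ws" ws length] assms by blast
  have "reduced us" using us least unfolding reduced_def by simp
  then show thesis using that us least assms by blast
qed

lemma reduced_tl: "reduced (s # ws) \<Longrightarrow> reduced ws"
  unfolding reduced_def
proof (intro conjI allI impI)
  fix us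
  assume *: "set (s # ws) \<subseteq> S \<and> (\<forall>us. set us \<subseteq> S \<longrightarrow> val us = val (s # ws) \<longrightarrow> length (s # ws) \<le> length us)"
    and us: "set us \<subseteq> S" "val us = val ws"
  have "length (s # ws) \<le> length (s # us)"
    using * us by (intro conjunct2[OF *, rule_format]) auto
  then show "length ws \<le> length us" by simp
qed simp

lemma reduced_length_eq: "reduced us \<Longrightarrow> reduced vs \<Longrightarrow> val us = val vs \<Longrightarrow> length us = length vs"
  unfolding reduced_def by (metis le_antisym)

lemma reducedI: "reduced us \<Longrightarrow> set vs \<subseteq> S \<Longrightarrow> val vs = val us \<Longrightarrow> length vs \<le> length us \<Longrightarrow> reduced vs"
  unfolding reduced_def by (metis le_trans)

text \<open>The values of the prefixes walk from \<open>\<one>\<close>, which lies in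
  \<open>P s\<close>, to a point outside. At the letter where the walk leaves \<open>P s\<close>,
  \<open>P_wall\<close> turns the crossing into an equation.\<close>

lemma cross_wall:
  assumes "set ws \<subseteq> S" "s \<in> S" "val ws \<notin> P s"
  shows "\<exists>i<length ws. s \<otimes> val (take i ws) = val (take (Suc i) ws)"
  using assms
proof (induction ws rule: rev_induct)
  case Nil
  then show ?case using one_in_P by simp
next
  case (snoc t ws)
  show ?case
  proof (cases "val ws \<in> P s")
    case True
    have "val (ws @ [t]) = val ws \<otimes> t" using snoc.prems by (simp add: val_append S_closed)
    then have "s \<otimes> val ws = val (ws @ [t])"
      using P_wall[of s t "val ws"] snoc.prems True by simp
    then show ?thesis by (intro exI[of _ "length ws"]) simp
  next
    case False
    then obtain i where "i < length ws" "s \<otimes> val (take i ws) = val (take (Suc i) ws)"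
      using snoc by auto
    then show ?thesis by (intro exI[of _ i]) simp
  qed
qed

text \<open>Crossing the wall at position \<open>i\<close> means that multiplying the longer prefix
  by \<open>s\<close> gives back the shorter one, so \<open>s\<close> absorbs that letter.\<close>

lemma delete_letter:
  assumes "set ws \<subseteq> S" "s \<in> S" "i < length ws" "s \<otimes> val (take i ws) = val (take (Suc i) ws)"
  shows "s \<otimes> val ws = val (take i ws @ drop (Suc i) ws)"
proof -
  have sub: "set (take i ws) \<subseteq> S" "set (take (Suc i) ws) \<subseteq> S" "set (drop (Suc i) ws) \<subseteq> S"
    using assms(1) by (meson order_trans set_take_subset set_drop_subset)+
  have "s \<otimes> val ws = s \<otimes> (val (take (Suc i) ws) \<otimes> val (drop (Suc i) ws))"
    using val_append[OF sub(2,3)] by simp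
  also have "\<dots> = val (take i ws) \<otimes> val (drop (Suc i) ws)"
    using sub assms(2) by (simp add: assms(4)[symmetric] m_assoc S_closed)
  finally show ?thesis using val_append[OF sub(1,3)] by simp
qed

lemma exchange:
  assumes "reduced ws" "s \<in> S" "\<not> reduced (s # ws)"
  shows "\<exists>i<length ws. s \<otimes> val (take i ws) = val (take (Suc i) ws)"
proof (rule cross_wall)
  show ws: "set ws \<subseteq> S" using assms(1) unfolding reduced_def by blast
  show "s \<in> S" by fact
  \<comment> \<open>Otherwise a shortest word \<open>us\<close> of
    \<open>s \<otimes> val ws\<close>, no longer than \<open>ws\<close>, has its value outside
    \<open>P s\<close>. Deleting a letter from it gives a word for \<open>val ws\<close> that is too
    short.\<close>
  show "val ws \<notin> P s"
  proof
    assume P: "val ws \<in> P s"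
    obtain us where us: "reduced us" "val us = val (s # ws)"
      using reduced_exists[of "s # ws"] ws assms(2) by auto
    have us_S: "set us \<subseteq> S" using us(1) unfolding reduced_def by blast
    have "length us \<noteq> length (s # ws)" "length us \<le> length (s # ws)"
      using assms(2,3) us ws reducedI[OF us(1), of "s # ws"] unfolding reduced_def by auto
    then have len: "length us \<le> length ws" by simp
    have "val us \<notin> P s" using P_disjoint[OF assms(2) _ P] ws us(2) by simp
    then obtain i where i: "i < length us" "s \<otimes> val (take i us) = val (take (Suc i) us)"
      using cross_wall[OF us_S assms(2)] by blast
    let ?vs = "take i us @ drop (Suc i) us"
    have "val ?vs = val ws"
      using delete_letter[OF us_S assms(2) i] us(2) ws assms(2) by simp
    moreover have "set ?vs \<subseteq> S"
      using us_S by (auto dest: in_set_takeD in_set_dropD)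
    ultimately have "length ws \<le> length ?vs"
      using assms(1) unfolding reduced_def by blast
    then show False using i(1) len by simp
  qed
qed

section \<open>Braid relations and the word problem\<close>

lemma ord_neq_zeroI: "g \<in> carrier G \<Longrightarrow> g [^] (n::nat) = \<one> \<Longrightarrow> 0 < n \<Longrightarrow> ord g \<noteq> 0"
  using pow_eq_id by (metis dvd_0_left_iff neq0_conv)

lemma exponent_enat: "coxeter_exponent G s t = enat n \<longleftrightarrow> n = ord (s \<otimes> t) \<and> n \<noteq> 0"
  unfolding coxeter_exponent_def Let_def by (auto split: if_splits)

lemma weq_square: "s \<in> S \<Longrightarrow> us @ [s, s] @ vs \<approx> us @ vs"
  using coxeter_word_eq.cw_relation[of s S s G 1 us vs]
  by (simp add: exponent_enat S_square)

lemma val_alternating_power: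
  "s \<in> S \<Longrightarrow> t \<in> S \<Longrightarrow> val (concat (replicate n [s, t])) = (s \<otimes> t) [^] n"
proof (induction n)
  case (Suc n)
  have "set (concat (replicate n [s, t])) \<subseteq> S" using Suc.prems by auto
  then show ?case
    using Suc nat_pow_Suc2[of "s \<otimes> t" n] by (simp add: m_assoc S_closed)
qed simp

lemma weq_sound: "us \<approx> vs \<Longrightarrow> (set us \<subseteq> S \<longleftrightarrow> set vs \<subseteq> S) \<and> (set us \<subseteq> S \<longrightarrow> val us = val vs)"
proof (induction rule: coxeter_word_eq.induct)
  case (cw_relation s t n us vs)
  let ?w = "concat (replicate n [s, t])"
  have w: "set ?w \<subseteq> S" using cw_relation by auto
  have "val ?w = \<one>"
    using cw_relation pow_ord_eq_1[of "s \<otimes> t"] by (simp add: val_alternating_power exponent_enat S_closed)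
  then show ?case using w by (auto simp: val_append)
qed auto

text \<open>The second half of the \<open>n\<close> pairs is the reverse of
  \<open>alternating t s n\<close>, so it cancels using squares alone. Hence the relation
  \<open>(s t)^n = 1\<close> and the braid relation of length \<open>n\<close> imply each
  other.\<close>

lemma alternating_weq:
  "s \<in> S \<Longrightarrow> t \<in> S \<Longrightarrow> alternating s t n \<approx> concat (replicate n [s, t]) @ alternating t s n"
proof (induction n arbitrary: s t)
  case 0
  then show ?case by (simp add: coxeter_word_eq.cw_refl)
next
  case (Suc n)
  have "s # alternating t s n \<approx> s # concat (replicate n [t, s]) @ alternating s t n"
    using Suc by (intro coxeter_word_eq_Cons) auto
  also have "s # concat (replicate n [t, s]) @ alternating s t n = (concat (replicate n [s, t]) @ [s]) @ alternating s t n"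
    by (simp flip: Cons_concat_replicate)
  finally have 1: "alternating s t (Suc n) \<approx> (concat (replicate n [s, t]) @ [s]) @ alternating s t n" by simp
  \<comment> \<open>The inserted \<open>t, t\<close> completes the last pair \<open>[s, t]\<close>
    and supplies the first letter of \<open>alternating t s (Suc n)\<close>.\<close>
  have "(concat (replicate n [s, t]) @ [s]) @ [t, t] @ alternating s t n \<approx> (concat (replicate n [s, t]) @ [s]) @ alternating s t n"
    using Suc.prems by (intro weq_square)
  moreover have "(concat (replicate n [s, t]) @ [s]) @ [t, t] @ alternating s t n = concat (replicate (Suc n) [s, t]) @ alternating t s (Suc n)"
    by (simp flip: replicate_append_same)
  ultimately show ?case
    using coxeter_word_eq.cw_trans[OF 1 coxeter_word_eq.cw_sym] by metis
qed

lemma alternating_val_eq: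
  assumes "s \<in> S" "t \<in> S" "val (alternating s t n) = val (alternating t s n)"
  shows "(s \<otimes> t) [^] n = \<one>"
proof -
  have sub: "set (alternating s t n) \<subseteq> S" "set (alternating t s n) \<subseteq> S" "set (concat (replicate n [s, t])) \<subseteq> S"
    using assms set_alternating[of s t n] set_alternating[of t s n] by auto
  have "val (alternating s t n) = (s \<otimes> t) [^] n \<otimes> val (alternating t s n)"
    using weq_sound[OF alternating_weq[OF assms(1,2), of n]] sub
    by (simp add: val_append val_alternating_power[OF assms(1,2)])
  then show ?thesis
    using assms sub by (metis S_closed m_closed nat_pow_closed r_cancel_one' val_closed)
qed

text \<open>Since the element also has a reduced word starting with \<open>t\<close>, multiplying by
  \<open>t\<close> shortens it, and exchange deletes a letter. A deletion inside the alternating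
  prefix would make a power of \<open>s \<otimes> t\<close> with exponent at most \<open>k\<close>
  trivial, so the deleted letter lies in \<open>r\<close> and \<open>t\<close> can be put in
  front.\<close>

lemma extend_alternating:
  assumes st: "s \<in> S" "t \<in> S" and order: "\<And>j. 0 < j \<Longrightarrow> j \<le> k \<Longrightarrow> (s \<otimes> t) [^] j \<noteq> \<one>"
    and red: "reduced (alternating s t k @ r)" "reduced (t # w)" "val (alternating s t k @ r) = val (t # w)"
  shows "\<exists>r'. reduced (alternating t s (Suc k) @ r') \<and> val (alternating t s (Suc k) @ r') = val (t # w)"
proof -
  let ?u = "alternating s t k @ r"
  have S: "set ?u \<subseteq> S" "set w \<subseteq> S" using red unfolding reduced_def by auto
  have len: "length ?u = Suc (length w)" using reduced_length_eq[OF red] by simp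
  have "\<not> reduced (t # ?u)"
  proof
    assume *: "reduced (t # ?u)"
    have "val w = val (t # ?u)" using red(3) S st by simp
    then show False using * S(2) len unfolding reduced_def by fastforce
  qed
  then obtain i where i: "i < length ?u" "t \<otimes> val (take i ?u) = val (take (Suc i) ?u)"
    using exchange[OF red(1) st(2)] by blast
  have "k \<le> i"
  proof (rule ccontr)
    assume "\<not> k \<le> i"
    then have "val (alternating t s (Suc i)) = val (alternating s t (Suc i))"
      using i(2) by (simp add: take_alternating del: alternating.simps(2)) simp
    then have "(s \<otimes> t) [^] Suc i = \<one>" using alternating_val_eq st by metis
    then show False using order[of "Suc i"] \<open>\<not> k \<le> i\<close> by simp
  qed
  let ?r = "take (i - k) r @ drop (Suc i - k) r"
  have eq: "take i ?u @ drop (Suc i) ?u = alternating s t k @ ?r"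
    using \<open>k \<le> i\<close> by simp
  have del: "t \<otimes> val ?u = val (alternating s t k @ ?r)"
    using delete_letter[OF S(1) st(2) i] unfolding eq .
  have r: "set ?r \<subseteq> S" using S(1) by (auto dest: in_set_takeD in_set_dropD)
  have "val (alternating t s (Suc k) @ ?r) = t \<otimes> (t \<otimes> val ?u)"
    using del by simp
  also have "\<dots> = val (t # w)" using S st red(3) by simp
  finally have "val (alternating t s (Suc k) @ ?r) = val (t # w)" .
  moreover have "reduced (alternating t s (Suc k) @ ?r)"
  proof (rule reducedI[OF red(2)])
    show "set (alternating t s (Suc k) @ ?r) \<subseteq> S"
      using r S(1) st by auto
    show "length (alternating t s (Suc k) @ ?r) \<le> length (t # w)"
      using i(1) \<open>k \<le> i\<close> len by auto
  qed fact
  ultimately show ?thesis by blast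
qed

lemma order_swap:
  assumes "s \<in> S" "t \<in> S" "(s \<otimes> t) [^] (j::nat) \<noteq> \<one>"
  shows "(t \<otimes> s) [^] j \<noteq> \<one>"
proof -
  have "inv s = s" "inv t = t"
    using assms S_square S_closed inv_equality by blast+
  then have "t \<otimes> s = inv (s \<otimes> t)"
    using assms by (simp add: inv_mult_group S_closed)
  then show ?thesis using assms by (simp add: S_closed nat_pow_inv)
qed

text \<open>Both prefixes are carried through the induction together, because each extension turns a
  word that starts with one of them into a word that starts with the other, one letter
  longer.\<close>

lemma alternating_prefix:
  assumes st: "s \<in> S" "t \<in> S" and red: "reduced (s # u)" "reduced (t # w)" "val (s # u) = val (t # w)"
    and order: "\<And>j. 0 < j \<Longrightarrow> j < k \<Longrightarrow> (s \<otimes> t) [^] j \<noteq> \<one>"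
  shows "(\<exists>r. reduced (alternating s t k @ r) \<and> val (alternating s t k @ r) = val (s # u)) \<and>
    (\<exists>r. reduced (alternating t s k @ r) \<and> val (alternating t s k @ r) = val (s # u))"
  using order
proof (induction k)
  case 0
  then show ?case using red by auto
next
  case (Suc k)
  then obtain r r' where r: "reduced (alternating s t k @ r)" "val (alternating s t k @ r) = val (s # u)"
    and r': "reduced (alternating t s k @ r')" "val (alternating t s k @ r') = val (s # u)"
    by (metis less_Suc_eq)
  have "\<exists>r. reduced (alternating t s (Suc k) @ r) \<and> val (alternating t s (Suc k) @ r) = val (t # w)"
    using r red Suc.prems by (intro extend_alternating[OF st]) auto
  moreover have "\<exists>r. reduced (alternating s t (Suc k) @ r) \<and> val (alternating s t (Suc k) @ r) = val (s # u)"
    using r' red Suc.prems order_swap[OF st] by (intro extend_alternating[OF st(2,1)]) auto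
  ultimately show ?case using red(3) by simp
qed

text \<open>Matsumoto's argument: two reduced words of the same element with different first letters
  \<open>s\<close> and \<open>t\<close> are linked through two reduced words whose prefixes are the two sides of the braid relation of
  \<open>s\<close> and \<open>t\<close>.\<close>

lemma reduced_words_weq:
  "reduced us \<Longrightarrow> reduced vs \<Longrightarrow> val us = val vs \<Longrightarrow> us \<approx> vs"
proof (induction "length us" arbitrary: us vs rule: less_induct)
  case less
  have same_head: "x # u \<approx> x # u'"
    if "reduced (x # u)" "reduced (x # u')" "val (x # u) = val (x # u')" "length (x # u) = length us" for x u u'
  proof (rule coxeter_word_eq_Cons, rule less.hyps)
    have S: "x \<in> S" "set u \<subseteq> S" "set u' \<subseteq> S" using that unfolding reduced_def by auto
    have "x \<otimes> (x \<otimes> val u) = x \<otimes> (x \<otimes> val u')" using that(3) by simp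
    then show "val u = val u'" using S by simp
    show "reduced u" "reduced u'" using that reduced_tl by blast+
    show "length u < length us" using that(4) by simp
  qed
  have len: "length us = length vs" using less.prems reduced_length_eq by blast
  show ?case
  proof (cases us)
    case Nil
    then show ?thesis using len by (simp add: coxeter_word_eq.cw_refl)
  next
    case us: (Cons s u)
    then obtain t w where vs: "vs = t # w" using len by (cases vs) auto
    have st: "s \<in> S" "t \<in> S" using less.prems us vs unfolding reduced_def by auto
    note red = less.prems[unfolded us vs]
    define m where "m = ord (s \<otimes> t)"
    have "m \<noteq> 0"
    proof
      assume "m = 0"
      then have "(s \<otimes> t) [^] j \<noteq> \<one>" if "0 < j" for j :: nat
        using that ord_neq_zeroI st unfolding m_def by blast
      \<comment> \<open>Infinite order would allow an alternating prefix longer than the reduced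
        word itself.\<close>
      then obtain r where "reduced (alternating s t (Suc (length us)) @ r)"
          "val (alternating s t (Suc (length us)) @ r) = val (s # u)"
        using alternating_prefix[OF st red, of "Suc (length us)"] by blast
      from reduced_length_eq[OF this(1) red(1) this(2)] us show False by simp
    qed
    then obtain m' where m': "m = Suc m'" by (cases m) auto
    have "(s \<otimes> t) [^] j \<noteq> \<one>" if "0 < j" "j < m" for j
      using that pow_eq_id[of "s \<otimes> t" j] st unfolding m_def by (auto dest: nat_dvd_not_less)
    then obtain r r' where r: "reduced (alternating s t m @ r)" "val (alternating s t m @ r) = val (s # u)"
      and r': "reduced (alternating t s m @ r')" "val (alternating t s m @ r') = val (s # u)"
      using alternating_prefix[OF st red, of m] by blast
    have "s # u \<approx> alternating s t m @ r"
      using same_head[of s u "alternating t s m' @ r"] r red us m' by simp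
    moreover have "alternating s t m \<approx> alternating t s m"
    proof -
      have "coxeter_exponent G s t = enat m"
        unfolding exponent_enat using \<open>m \<noteq> 0\<close> by (simp add: m_def)
      then have "concat (replicate m [s, t]) @ alternating t s m \<approx> alternating t s m"
        using coxeter_word_eq.cw_relation[OF st, of G m "[]" "alternating t s m"] by simp
      then show ?thesis using alternating_weq[OF st] coxeter_word_eq.cw_trans by metis
    qed
    then have swap: "alternating s t m @ r \<approx> alternating t s m @ r"
      by (rule coxeter_word_eq_append)
    \<comment> \<open>The braid move keeps length and value, so the word stays reduced and now
      shares its first letter with \<open>t # w\<close>.\<close>
    moreover have "alternating t s m @ r \<approx> t # w"
    proof -
      have *: "set (alternating t s m @ r) \<subseteq> S" "val (alternating t s m @ r) = val (s # u)"
        using weq_sound[OF swap] r unfolding reduced_def by auto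
      then have **: "reduced (alternating t s m @ r)"
        using reducedI[OF r(1)] r(2) by simp
      show ?thesis
        using same_head[of t "alternating s t m' @ r" w] red * ** m' reduced_length_eq[OF ** red(1) *(2)] us
        by simp
    qed
    ultimately show ?thesis
      unfolding us vs by (blast intro: coxeter_word_eq.cw_trans)
  qed
qed

text \<open>If prepending \<open>s\<close> to a reduced word spoils reducedness, exchange provides a
  reduced word of the same element that starts with \<open>s\<close>. The two reduced words are
  equivalent by \<open>reduced_words_weq\<close>, and then \<open>s, s\<close> cancels.\<close>

lemma weq_reduced:
  assumes "set ws \<subseteq> S"
  obtains us where "reduced us" "ws \<approx> us"
proof -
  have "\<exists>us. reduced us \<and> ws \<approx> us"
    using assms
  proof (induction ws)
    case Nil
    then show ?case by (intro exI[of _ "[]"]) (simp add: reduced_def coxeter_word_eq.cw_refl)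
  next
    case (Cons s ws)
    then obtain us where us: "reduced us" "ws \<approx> us" by auto
    then have eq: "s # ws \<approx> s # us" by (simp add: coxeter_word_eq_Cons)
    have s: "s \<in> S" and us_S: "set us \<subseteq> S" using Cons us unfolding reduced_def by auto
    show ?case
    proof (cases "reduced (s # us)")
      case True
      then show ?thesis using eq by blast
    next
      case False
      then obtain i where i: "i < length us" "s \<otimes> val (take i us) = val (take (Suc i) us)"
        using exchange[OF us(1) s] by blast
      let ?r = "take i us @ drop (Suc i) us"
      have r: "set ?r \<subseteq> S" using us_S by (auto dest: in_set_takeD in_set_dropD)
      have "val (s # ?r) = val us"
        using delete_letter[OF us_S s i] us_S s by (metis S_cancel val_closed word_value_simps(2))
      moreover from this have red: "reduced (s # ?r)"
        using s r i(1) by (intro reducedI[OF us(1)]) auto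
      ultimately have "us \<approx> s # ?r" using us(1) by (intro reduced_words_weq) auto
      then have "s # us \<approx> s # s # ?r" by (rule coxeter_word_eq_Cons)
      moreover have "s # s # ?r \<approx> ?r" using weq_square[OF s, of "[]" ?r] by simp
      ultimately have "s # ws \<approx> ?r"
        using eq coxeter_word_eq.cw_trans by metis
      then show ?thesis using reduced_tl[OF red] by blast
    qed
  qed
  then show thesis using that by blast
qed

theorem coxeter_system: "coxeter_system G S"
  unfolding coxeter_system_def
proof (intro conjI ballI)
  show "group G" by (rule is_group)
  fix us vs assume "us \<in> lists S" "vs \<in> lists S"
  then have S: "set us \<subseteq> S" "set vs \<subseteq> S" by auto
  show "val us = val vs \<longleftrightarrow> us \<approx> vs"
  proof
    assume eq: "val us = val vs"
    obtain us' vs' where red: "reduced us'" "us \<approx> us'" "reduced vs'" "vs \<approx> vs'"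
      using weq_reduced S by metis
    have "val us' = val vs'" using eq weq_sound[OF red(2)] weq_sound[OF red(4)] S by simp
    then have "us' \<approx> vs'" by (intro reduced_words_weq red)
    then show "us \<approx> vs" using red by (blast intro: coxeter_word_eq.cw_trans coxeter_word_eq.cw_sym)
  qed (use weq_sound S in blast)
qed (use S_carrier generate_S S_neq_one S_square in auto)

end

section \<open>Weights of the half-baked algebra\<close>

lemma linear_zero: "Vector_Spaces.linear s1 s2 f \<Longrightarrow> f 0 = 0"
  unfolding Vector_Spaces.linear_iff_module_hom by (rule module_hom.zero)

lemma lookup_fscale [simp]: "Poly_Mapping.lookup (fscale c u) t = c * Poly_Mapping.lookup u t"
  by (simp add: fscale_def Poly_Mapping.map.rep_eq when_def)

global_interpretation free_alg: vector_space "fscale :: complex \<Rightarrow> ('x, 'h) free_algebra \<Rightarrow> _"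
  by unfold_locales (auto intro!: poly_mapping_eqI simp: lookup_add algebra_simps)

abbreviation mono_elt :: "('x, 'h) monomial \<Rightarrow> ('x, 'h) free_algebra"
  where "mono_elt t \<equiv> Poly_Mapping.single t 1"

lemma fscale_single [simp]: "fscale c (Poly_Mapping.single t d) = Poly_Mapping.single t (c * d)"
  by (rule poly_mapping_eqI) (simp add: lookup_single when_def)

text \<open>Key sets shrink when coefficients cancel. Summing over fixed finite supersets lets
  bilinearity be checked term by term.\<close>

lemma fbracket_expand:
  assumes "finite A" "finite B" "Poly_Mapping.keys u \<subseteq> A" "Poly_Mapping.keys w \<subseteq> B"
  shows "fbracket u w = (\<Sum>s\<in>A. \<Sum>t\<in>B.
    Poly_Mapping.single (Br s t) (Poly_Mapping.lookup u s * Poly_Mapping.lookup w t))"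
proof -
  have "(\<Sum>t\<in>Poly_Mapping.keys w. Poly_Mapping.single (Br s t) (Poly_Mapping.lookup u s * Poly_Mapping.lookup w t)) =
     (\<Sum>t\<in>B. Poly_Mapping.single (Br s t) (Poly_Mapping.lookup u s * Poly_Mapping.lookup w t))" for s
    by (rule sum.mono_neutral_left) (use assms in \<open>auto simp: in_keys_iff\<close>)
  then show ?thesis
    unfolding fbracket_def
    by (simp only:) (rule sum.mono_neutral_left, use assms in \<open>auto simp: in_keys_iff\<close>)
qed

lemma fbracket_single [simp]:
  "fbracket (Poly_Mapping.single s c) (Poly_Mapping.single t d) = Poly_Mapping.single (Br s t) (c * d)"
  by (subst fbracket_expand[of "{s}" "{t}"]) auto

lemma fbracket_add_left: "fbracket (u + u') w = fbracket u w + fbracket u' w"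
proof -
  let ?A = "Poly_Mapping.keys u \<union> Poly_Mapping.keys u'" and ?B = "Poly_Mapping.keys w"
  have *: "Poly_Mapping.keys (u + u') \<subseteq> ?A" by (rule Poly_Mapping.keys_add)
  show ?thesis
    by (simp add: fbracket_expand[of ?A ?B] * lookup_add single_add sum.distrib distrib_right)
qed

lemma fbracket_add_right: "fbracket u (w + w') = fbracket u w + fbracket u w'"
proof -
  let ?A = "Poly_Mapping.keys u" and ?B = "Poly_Mapping.keys w \<union> Poly_Mapping.keys w'"
  have *: "Poly_Mapping.keys (w + w') \<subseteq> ?B" by (rule Poly_Mapping.keys_add)
  show ?thesis
    by (simp add: fbracket_expand[of ?A ?B] * lookup_add single_add sum.distrib distrib_left)
qed

lemma keys_fscale: "Poly_Mapping.keys (fscale c u) \<subseteq> Poly_Mapping.keys u"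
  by (auto simp: in_keys_iff)

lemma fbracket_scale_left: "fbracket (fscale c u) w = fscale c (fbracket u w)"
proof -
  let ?A = "Poly_Mapping.keys u" and ?B = "Poly_Mapping.keys w"
  show ?thesis
    by (simp add: fbracket_expand[of ?A ?B] keys_fscale free_alg.scale_sum_right mult.assoc)
qed

lemma fbracket_scale_right: "fbracket u (fscale c w) = fscale c (fbracket u w)"
proof -
  let ?A = "Poly_Mapping.keys u" and ?B = "Poly_Mapping.keys w"
  show ?thesis
    by (simp add: fbracket_expand[of ?A ?B] keys_fscale free_alg.scale_sum_right mult.left_commute)
qed

lemma fbracket_zero_right [simp]: "fbracket u 0 = 0"
  by (simp add: fbracket_def)

lemma fbracket_diff_left: "fbracket (u - u') w = fbracket u w - fbracket u' w"
  by (metis add_diff_cancel diff_add_cancel fbracket_add_left)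

lemma fbracket_diff_right: "fbracket u (w - w') = fbracket u w - fbracket u w'"
  by (metis add_diff_cancel diff_add_cancel fbracket_add_right)

lemma fbracket_sum_right: "fbracket u (\<Sum>i\<in>I. f i) = (\<Sum>i\<in>I. fbracket u (f i))"
  by (induction I rule: infinite_finite_induct) (simp_all add: fbracket_add_right)

lemma mono_elt_homogeneous: "mono_elt t \<in> homogeneous v (monomial_parity v t)"
  by (simp add: homogeneous_def)

lemma poly_mapping_sum_mono_elt:
  fixes u :: "('x, 'h) free_algebra"
  shows "u = (\<Sum>t\<in>Poly_Mapping.keys u. fscale (Poly_Mapping.lookup u t) (mono_elt t))"
  by (rule poly_mapping_eqI)
    (auto simp: lookup_sum lookup_single when_def in_keys_iff intro!: sum.neutral)

section \<open>Monomials, formal weights and their functionals\<close>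

primrec root_generator :: "bool \<Rightarrow> 'x \<Rightarrow> ('x, 'h) generator"
  where "root_generator True x = RootE x" | "root_generator False x = RootF x"

text \<open>There is no monomial for the empty word, so that value is a dummy; the spanning sets
  below admit only nonempty words.\<close>

fun root_word :: "bool \<Rightarrow> 'x list \<Rightarrow> ('x, 'h) monomial"
  where
    "root_word s [] = undefined"
  | "root_word s [x] = Gen (root_generator s x)"
  | "root_word s (x # y # ys) = Br (Gen (root_generator s x)) (root_word s (y # ys))"

fun generator_weight :: "('x, 'h) generator \<Rightarrow> 'x \<Rightarrow> int"
  where
    "generator_weight (Cart h) y = 0"
  | "generator_weight (RootE x) y = (if y = x then 1 else 0)"
  | "generator_weight (RootF x) y = (if y = x then - 1 else 0)"

primrec weight :: "('x, 'h) monomial \<Rightarrow> 'x \<Rightarrow> int"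
  where
    "weight (Gen g) = generator_weight g"
  | "weight (Br s t) = (\<lambda>y. weight s y + weight t y)"

definition root_sum :: "('x::finite, 'h) root_datum \<Rightarrow> ('x \<Rightarrow> int) \<Rightarrow> 'h \<Rightarrow> complex"
  where "root_sum v n h = (\<Sum>y\<in>UNIV. of_int (n y) * root_b v y h)"

lemma root_sum_add: "root_sum v (\<lambda>y. n y + m y) h = root_sum v n h + root_sum v m h"
  by (simp add: root_sum_def distrib_right sum.distrib)

lemma root_sum_zero [simp]: "root_sum v (\<lambda>y. 0) h = 0"
  by (simp add: root_sum_def)

lemma root_sum_single: "root_sum v (\<lambda>y. if y = x then c else 0) h = of_int c * root_b v x h"
proof -
  have "root_sum v (\<lambda>y. if y = x then c else 0) h = (\<Sum>y\<in>UNIV. if y = x then of_int c * root_b v y h else 0)"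
    unfolding root_sum_def by (rule sum.cong) auto
  then show ?thesis by simp
qed

lemma generator_root_sum:
  "root_sum v (generator_weight (root_generator s x :: ('x::finite, 'h) generator)) h = (if s then 1 else - 1) * root_b v x h"
proof -
  have "generator_weight (root_generator s x :: ('x, 'h) generator) = (\<lambda>y. if y = x then (if s then 1 else - 1) else 0)"
    by (cases s) (auto simp: fun_eq_iff)
  then show ?thesis by (simp add: root_sum_single)
qed

lemma root_b_independent:
  assumes "valid_root_datum v" "\<And>h. (\<Sum>x\<in>UNIV. c x * root_b v x h) = 0"
  shows "c x = 0"
  using assms(1)[unfolded valid_root_datum_def, THEN conjunct2, THEN conjunct2, rule_format, of c x] assms(2)
  by blast

lemma coroot_a_independent:
  assumes "valid_root_datum v" "(\<Sum>x\<in>UNIV. c x *\<^sub>C coroot_a v x) = 0"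
  shows "c x = 0"
  using assms(1)[unfolded valid_root_datum_def, THEN conjunct2, THEN conjunct1, rule_format, of c x] assms(2)
  by blast

text \<open>Linear independence of the roots recovers a formal weight from its functional.
  Uniqueness of the coefficients of a root at a given object rests on this.\<close>

lemma root_sum_eq_iff:
  assumes "valid_root_datum v"
  shows "root_sum v n = root_sum v m \<longleftrightarrow> n = m"
proof
  assume eq: "root_sum v n = root_sum v m"
  have "(\<Sum>y\<in>UNIV. complex_of_int (n y - m y) * root_b v y h) = 0" for h
    using fun_cong[OF eq, of h] by (simp add: root_sum_def left_diff_distrib sum_subtractf)
  then have "complex_of_int (n y - m y) = 0" for y
    using root_b_independent[OF assms, of "\<lambda>y. complex_of_int (n y - m y)"] by blast
  then show "n = m" by (simp add: fun_eq_iff del: of_int_diff)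
qed auto

locale half_baked =
  fixes v :: "('x::finite, 'h::fin_dim_complex_vector) root_datum" and K
  assumes valid: "valid_root_datum v"
    and quotient: "half_baked_quotient v K"
begin

lemma relators_subset: "relators v \<subseteq> K"
  using quotient unfolding half_baked_quotient_def half_baked_ideal_def by blast

lemma ideal: "superideal v K"
  using quotient unfolding half_baked_quotient_def by blast

lemma gen_h_eq_zero: "gen_h h \<in> K \<Longrightarrow> h = 0"
  using quotient unfolding half_baked_quotient_def by blast

lemma subspace_K: "free_alg.subspace K"
  using ideal unfolding superideal_def free_alg.subspace_def by blast

lemmas K_zero = free_alg.subspace_0[OF subspace_K]
  and K_add = free_alg.subspace_add[OF subspace_K]
  and K_diff = free_alg.subspace_diff[OF subspace_K]
  and K_neg = free_alg.subspace_neg[OF subspace_K]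
  and K_scale = free_alg.subspace_scale[OF subspace_K]
  and K_sum = free_alg.subspace_sum[OF subspace_K]

lemma K_bracket: "u \<in> K \<Longrightarrow> fbracket u w \<in> K" "u \<in> K \<Longrightarrow> fbracket w u \<in> K"
  using ideal unfolding superideal_def by blast+

lemma cfunctional_root: "cfunctional (root_b v x)"
  using valid unfolding valid_root_datum_def by blast

lemma gen_h_zero: "gen_h 0 \<in> K"
  using relators.H_scale[of 0 0 v] relators_subset by (auto simp: subset_iff)

lemma jacobi:
  "fbracket (mono_elt s) (fbracket (mono_elt t) (mono_elt r)) - fbracket (fbracket (mono_elt s) (mono_elt t)) (mono_elt r)
    - fscale (koszul (monomial_parity v s) (monomial_parity v t))
        (fbracket (mono_elt t) (fbracket (mono_elt s) (mono_elt r))) \<in> K"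
  by (rule subsetD[OF relators_subset relators.super_jacobi]; rule mono_elt_homogeneous)

lemma antisymmetry:
  "fbracket (mono_elt s) (mono_elt t)
    + fscale (koszul (monomial_parity v s) (monomial_parity v t)) (fbracket (mono_elt t) (mono_elt s)) \<in> K"
  by (rule subsetD[OF relators_subset relators.super_antisymmetry]; rule mono_elt_homogeneous)

text \<open>Elements of the Cartan part are even, so by Jacobi their action is an ordinary
  derivation modulo \<open>K\<close>, and eigenvalues add under brackets.\<close>

lemma cartan_bracket_mono_elt:
  "fbracket (gen_h h) (mono_elt t) - fscale (root_sum v (weight t) h) (mono_elt t) \<in> K"
proof (induction t)
  case (Gen g)
  show ?case
  proof (cases g)
    case (Cart k)
    have "fbracket (gen_h h) (gen_h k) \<in> K"
      by (rule subsetD[OF relators_subset relators.H_H])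
    moreover have "weight (Gen g) = (\<lambda>y. 0)" using Cart by (simp add: fun_eq_iff)
    ultimately show ?thesis using Cart by (simp add: gen_h_def)
  next
    case (RootE x)
    have "fbracket (gen_h h) (gen_e x) - fscale (root_b v x h) (gen_e x) \<in> K"
      by (rule subsetD[OF relators_subset relators.H_E])
    moreover have "weight (Gen g) = (\<lambda>y. if y = x then 1 else 0)" using RootE by (simp add: fun_eq_iff)
    ultimately show ?thesis using RootE by (simp add: gen_h_def gen_e_def root_sum_single)
  next
    case (RootF x)
    have "fbracket (gen_h h) (gen_f x) + fscale (root_b v x h) (gen_f x) \<in> K"
      by (rule subsetD[OF relators_subset relators.H_F])
    moreover have "weight (Gen g) = (\<lambda>y. if y = x then - 1 else 0)" using RootF by (simp add: fun_eq_iff)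
    ultimately show ?thesis
      using RootF by (simp add: gen_h_def gen_f_def root_sum_single single_uminus)
  qed
next
  case (Br s t)
  let ?h = "Gen (Cart h)" and ?m = "root_sum v (weight s) h" and ?n = "root_sum v (weight t) h"
  have "fbracket (mono_elt ?h) (fbracket (mono_elt s) (mono_elt t)) - fbracket (fbracket (mono_elt ?h) (mono_elt s)) (mono_elt t)
    - fbracket (mono_elt s) (fbracket (mono_elt ?h) (mono_elt t)) \<in> K"
    using jacobi[of ?h s t] by (simp add: koszul_def)
  moreover have "fbracket (fbracket (gen_h h) (mono_elt s) - fscale ?m (mono_elt s)) (mono_elt t) \<in> K"
    by (rule K_bracket) (rule Br.IH)
  moreover have "fbracket (mono_elt s) (fbracket (gen_h h) (mono_elt t) - fscale ?n (mono_elt t)) \<in> K"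
    by (rule K_bracket) (rule Br.IH)
  ultimately have "(fbracket (mono_elt ?h) (fbracket (mono_elt s) (mono_elt t)) - fbracket (fbracket (mono_elt ?h) (mono_elt s)) (mono_elt t)
    - fbracket (mono_elt s) (fbracket (mono_elt ?h) (mono_elt t))) + fbracket (fbracket (gen_h h) (mono_elt s) - fscale ?m (mono_elt s)) (mono_elt t)
     + fbracket (mono_elt s) (fbracket (gen_h h) (mono_elt t) - fscale ?n (mono_elt t)) \<in> K"
    by (intro K_add)
  moreover have "root_sum v (weight (Br s t)) h = ?m + ?n"
    by (simp add: root_sum_add)
  ultimately show ?case
    by (simp add: gen_h_def fbracket_diff_left fbracket_diff_right single_diff algebra_simps flip: single_add)
qed

text \<open>Modulo \<open>K\<close>, the elements of weight \<open>n\<close>. Taking right-nested words in generators of one sign makes the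
  triangular decomposition part of the definition; what has to be shown is that every monomial lies in the space of its weight.\<close>

definition signed_space :: "bool \<Rightarrow> ('x \<Rightarrow> int) \<Rightarrow> ('x, 'h) free_algebra set"
  where "signed_space s n = free_alg.span
    (K \<union> {mono_elt (root_word s xs) | xs. xs \<noteq> [] \<and> weight (root_word s xs :: ('x, 'h) monomial) = n}
       \<union> {gen_h h | h. n = (\<lambda>y. 0)})"

text \<open>The last set is empty unless the weight is zero, where it contributes the whole Cartan
  part.\<close>

definition weight_space :: "('x \<Rightarrow> int) \<Rightarrow> ('x, 'h) free_algebra set"
  where "weight_space n = free_alg.span
    (K \<union> {mono_elt (root_word s xs) | s xs. xs \<noteq> [] \<and> weight (root_word s xs :: ('x, 'h) monomial) = n}
       \<union> {gen_h h | h. n = (\<lambda>y. 0)})"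

section \<open>The spanning half of the triangular decomposition\<close>

lemma signed_space_subset: "signed_space s n \<subseteq> weight_space n"
  unfolding signed_space_def weight_space_def
  by (rule free_alg.span_mono[OF Un_mono[OF Un_mono[OF order_refl] order_refl]]) (rule subsetI, erule CollectE, rule CollectI, metis)

lemma K_subset_signed: "K \<subseteq> signed_space s n"
  unfolding signed_space_def by (intro order_trans[OF _ free_alg.span_superset] le_supI1 order_refl)

lemma K_subset_weight: "K \<subseteq> weight_space n"
  unfolding weight_space_def by (intro order_trans[OF _ free_alg.span_superset] le_supI1 order_refl)

lemma root_word_in_signed:
  "xs \<noteq> [] \<Longrightarrow> weight (root_word s xs :: ('x, 'h) monomial) = n \<Longrightarrow> mono_elt (root_word s xs) \<in> signed_space s n"
  unfolding signed_space_def by (rule free_alg.span_base, rule UnI1, rule UnI2, rule CollectI) metis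

lemma gen_h_in_signed: "gen_h h \<in> signed_space s (\<lambda>y. 0)"
  unfolding signed_space_def by (rule free_alg.span_base, rule UnI2, rule CollectI) metis

lemma signed_subspace: "free_alg.subspace (signed_space s n)"
  unfolding signed_space_def by (rule free_alg.subspace_span)

lemma weight_subspace: "free_alg.subspace (weight_space n)"
  unfolding weight_space_def by (rule free_alg.subspace_span)

lemma fbracket_preimage_subspace:
  assumes "free_alg.subspace V"
  shows "free_alg.subspace {r. fbracket u r \<in> V}"
  using assms by (auto simp: free_alg.subspace_def fbracket_add_right fbracket_scale_right)

lemma signed_space_induct:
  assumes "r \<in> signed_space s n" "free_alg.subspace V"
    and "\<And>u. u \<in> K \<Longrightarrow> fbracket w u \<in> V"
    and "\<And>xs. xs \<noteq> [] \<Longrightarrow> weight (root_word s xs :: ('x, 'h) monomial) = n \<Longrightarrow> fbracket w (mono_elt (root_word s xs)) \<in> V"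
    and "\<And>h. n = (\<lambda>y. 0) \<Longrightarrow> fbracket w (gen_h h) \<in> V"
  shows "fbracket w r \<in> V"
proof -
  have "r \<in> {r. fbracket w r \<in> V}"
    using assms(1) unfolding signed_space_def
    by (rule free_alg.span_induct) (use assms fbracket_preimage_subspace in auto)
  then show ?thesis by simp
qed

lemma weight_space_induct:
  assumes "r \<in> weight_space n" "free_alg.subspace V"
    and "\<And>u. u \<in> K \<Longrightarrow> fbracket w u \<in> V"
    and "\<And>s xs. xs \<noteq> [] \<Longrightarrow> weight (root_word s xs :: ('x, 'h) monomial) = n \<Longrightarrow> fbracket w (mono_elt (root_word s xs)) \<in> V"
    and "\<And>h. n = (\<lambda>y. 0) \<Longrightarrow> fbracket w (gen_h h) \<in> V"
  shows "fbracket w r \<in> V"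
proof -
  have "r \<in> {r. fbracket w r \<in> V}"
    using assms(1) unfolding weight_space_def
    by (rule free_alg.span_induct) (use assms fbracket_preimage_subspace in auto)
  then show ?thesis by simp
qed

lemma root_word_Cons:
  "xs \<noteq> [] \<Longrightarrow> root_word s (x # xs) = Br (Gen (root_generator s x)) (root_word s xs)"
  by (cases xs) auto

text \<open>On words the bracket prepends a letter. On a Cartan element antisymmetry reduces it to
  the action on a generator, which gives a multiple of that generator.\<close>

lemma bracket_same_sign:
  assumes "r \<in> signed_space s n"
  shows "fbracket (mono_elt (Gen (root_generator s x))) r
    \<in> signed_space s (\<lambda>y. n y + generator_weight (root_generator s x :: ('x, 'h) generator) y)"
    (is "_ \<in> ?V")
  using assms signed_subspace
proof (rule signed_space_induct)
  fix u assume "u \<in> K"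
  then show "fbracket (mono_elt (Gen (root_generator s x))) u \<in> ?V"
    by (rule subsetD[OF K_subset_signed K_bracket(2)])
next
  fix xs assume xs: "xs \<noteq> []" "weight (root_word s xs :: ('x, 'h) monomial) = n"
  then show "fbracket (mono_elt (Gen (root_generator s x))) (mono_elt (root_word s xs)) \<in> ?V"
    using root_word_in_signed[of "x # xs" s] by (simp add: root_word_Cons add.commute)
next
  fix h :: 'h
  assume n: "n = (\<lambda>y. 0)"
  let ?g = "Gen (root_generator s x) :: ('x, 'h) monomial"
  have m: "mono_elt ?g \<in> ?V"
    using root_word_in_signed[of "[x]" s] n by simp
  have 1: "fbracket (mono_elt ?g) (gen_h h) + fbracket (gen_h h) (mono_elt ?g) \<in> K"
    using antisymmetry[of ?g "Gen (Cart h)"] by (simp add: koszul_def gen_h_def)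
  have 2: "fbracket (gen_h h) (mono_elt ?g) - fscale (root_sum v (weight ?g) h) (mono_elt ?g) \<in> K"
    by (rule cartan_bracket_mono_elt)
  have "fbracket (mono_elt ?g) (gen_h h) + fscale (root_sum v (weight ?g) h) (mono_elt ?g) \<in> K"
    using K_diff[OF 1 2] by (simp add: algebra_simps)
  then have "(fbracket (mono_elt ?g) (gen_h h) + fscale (root_sum v (weight ?g) h) (mono_elt ?g))
     - fscale (root_sum v (weight ?g) h) (mono_elt ?g) \<in> ?V"
    by (intro free_alg.subspace_diff[OF signed_subspace] free_alg.subspace_scale[OF signed_subspace]
        subsetD[OF K_subset_signed] m)
  then show "fbracket (mono_elt ?g) (gen_h h) \<in> ?V" by simp
qed

text \<open>Antisymmetry supplies the order of arguments absent from the defining relations. The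
  resulting scalar is hidden in \<open>c\<close>, because only membership in the Cartan part, and
  vanishing for distinct indices, matters later.\<close>

lemma opposite_generators:
  obtains c where
    "fbracket (mono_elt (Gen (root_generator (\<not> s) y))) (mono_elt (Gen (root_generator s x))) - gen_h c \<in> K"
    "x \<noteq> y \<Longrightarrow> c = 0"
proof -
  have ef: "fbracket (gen_e y) (gen_f x) \<in> K" if "x \<noteq> y" for x y
    by (rule subsetD[OF relators_subset relators.E_F_distinct]) (use that in auto)
  have efs: "fbracket (gen_e x) (gen_f x) - gen_h (coroot_a v x) \<in> K"
    by (rule subsetD[OF relators_subset relators.E_F_same])
  have fe: "\<exists>k. fbracket (gen_f y) (gen_e x) + fscale k (fbracket (gen_e x) (gen_f y)) \<in> K" for x y
    using antisymmetry[of "Gen (RootF y)" "Gen (RootE x)"] unfolding gen_e_def gen_f_def by blast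
  show thesis
  proof (cases "x = y")
    case False
    show thesis
    proof (rule that[of 0])
      have 1: "fbracket (gen_e y) (gen_f x) - gen_h 0 \<in> K"
        by (rule K_diff[OF ef[OF False] gen_h_zero])
      obtain k where k: "fbracket (gen_f y) (gen_e x) + fscale k (fbracket (gen_e x) (gen_f y)) \<in> K"
        using fe by blast
      have "fscale k (fbracket (gen_e x) (gen_f y)) \<in> K"
        using False by (intro K_scale ef) auto
      from K_diff[OF K_diff[OF k this] gen_h_zero]
      have 2: "fbracket (gen_f y) (gen_e x) - gen_h 0 \<in> K"
        by simp
      show "fbracket (mono_elt (Gen (root_generator (\<not> s) y))) (mono_elt (Gen (root_generator s x))) - gen_h 0 \<in> K"
        using 1 2 by (cases s) (auto simp: gen_e_def gen_f_def)
    qed simp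
  next
    case True
    show thesis
    proof (cases s)
      case False
      then show thesis using that[of "coroot_a v x"] efs True by (auto simp: gen_e_def gen_f_def)
    next
      case s: True
      obtain c where c: "fbracket (gen_f x) (gen_e x) + fscale c (fbracket (gen_e x) (gen_f x)) \<in> K"
        using fe by blast
      have 1: "fscale c (fbracket (gen_e x) (gen_f x)) - fscale c (gen_h (coroot_a v x)) \<in> K"
        using K_scale[OF efs, of c] by (simp add: free_alg.scale_right_diff_distrib)
      have 2: "gen_h (- c *\<^sub>C coroot_a v x) - fscale (- c) (gen_h (coroot_a v x)) \<in> K"
        by (rule subsetD[OF relators_subset relators.H_scale])
      have "fbracket (gen_f x) (gen_e x) - gen_h (- c *\<^sub>C coroot_a v x) \<in> K"
        using K_diff[OF K_diff[OF c 1] 2] by (simp add: algebra_simps)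
      then show thesis using that[of "- c *\<^sub>C coroot_a v x"] True s by (auto simp: gen_e_def gen_f_def)
    qed
  qed
qed

lemma opposite_weight:
  "generator_weight (root_generator (\<not> s) x :: ('x, 'h) generator) y = - generator_weight (root_generator s x :: ('x, 'h) generator) y"
  by (cases s) auto

text \<open>Jacobi moves the opposite generator past the first letter. The commutator of the two
  generators lies in the Cartan part and acts on the remaining word by a scalar; the other term is
  the induction hypothesis followed by \<open>bracket_same_sign\<close>.\<close>

lemma bracket_opposite_sign:
  assumes "xs \<noteq> []"
  shows "fbracket (mono_elt (Gen (root_generator (\<not> s) y))) (mono_elt (root_word s xs))
    \<in> signed_space s (\<lambda>z. weight (root_word s xs :: ('x, 'h) monomial) z
         + generator_weight (root_generator (\<not> s) y :: ('x, 'h) generator) z)"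
  using assms
proof (induction xs)
  case Nil
  then show ?case by simp
next
  case (Cons x xs)
  let ?gy = "Gen (root_generator (\<not> s) y) :: ('x, 'h) monomial"
  let ?gx = "Gen (root_generator s x) :: ('x, 'h) monomial"
  let ?V = "signed_space s (\<lambda>z. weight (root_word s (x # xs) :: ('x, 'h) monomial) z
         + generator_weight (root_generator (\<not> s) y :: ('x, 'h) generator) z)"
  note sub = free_alg.subspace_add[OF signed_subspace] free_alg.subspace_diff[OF signed_subspace]
    free_alg.subspace_scale[OF signed_subspace]
  obtain c where c: "fbracket (mono_elt ?gy) (mono_elt ?gx) - gen_h c \<in> K" "x \<noteq> y \<Longrightarrow> c = 0"
    using opposite_generators[of s y x] by blast
  show ?case
  proof (cases "xs = []")
    case True
    have "gen_h c \<in> ?V"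
    proof (cases "x = y")
      case True
      then show ?thesis using gen_h_in_signed[of c s] by (simp add: opposite_weight \<open>xs = []\<close>)
    next
      case False
      then show ?thesis using c(2) by (auto intro: subsetD[OF K_subset_signed] gen_h_zero)
    qed
    then have "(fbracket (mono_elt ?gy) (mono_elt ?gx) - gen_h c) + gen_h c \<in> ?V"
      by (intro sub subsetD[OF K_subset_signed c(1)])
    then show ?thesis using True by simp
  next
    case False
    let ?r = "root_word s xs :: ('x, 'h) monomial"
    let ?k = "koszul (monomial_parity v ?gy) (monomial_parity v ?gx)"
    let ?d = "root_sum v (weight ?r) c"
    have 1: "fbracket (mono_elt ?gy) (fbracket (mono_elt ?gx) (mono_elt ?r))
       - fbracket (fbracket (mono_elt ?gy) (mono_elt ?gx)) (mono_elt ?r)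
       - fscale ?k (fbracket (mono_elt ?gx) (fbracket (mono_elt ?gy) (mono_elt ?r))) \<in> K"
      by (rule jacobi)
    have 2: "fbracket (fbracket (mono_elt ?gy) (mono_elt ?gx)) (mono_elt ?r) - fbracket (gen_h c) (mono_elt ?r) \<in> K"
      using K_bracket(1)[OF c(1), of "mono_elt ?r"] by (simp add: fbracket_diff_left)
    have 3: "fbracket (gen_h c) (mono_elt ?r) - fscale ?d (mono_elt ?r) \<in> K"
      by (rule cartan_bracket_mono_elt)
    \<comment> \<open>For \<open>x = y\<close> the two letters cancel in the weight, so
      \<open>?r\<close> has the target weight; otherwise \<open>c = 0\<close> makes the scalar
      vanish.\<close>
    have 4: "fscale ?d (mono_elt ?r) \<in> ?V"
    proof (cases "x = y")
      case True
      have "mono_elt ?r \<in> ?V"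
        by (rule root_word_in_signed[OF False]) (simp add: root_word_Cons[OF False] opposite_weight True fun_eq_iff)
      then show ?thesis by (rule sub)
    next
      case neq: False
      have "root_b v z 0 = 0" for z
        by (rule linear_zero[OF cfunctional_root])
      then have "?d = 0" using c(2)[OF neq] by (simp add: root_sum_def)
      then show ?thesis using free_alg.subspace_0[OF signed_subspace] by (metis free_alg.scale_zero_left)
    qed
    have "fbracket (mono_elt ?gx) (fbracket (mono_elt ?gy) (mono_elt ?r)) \<in> ?V"
      using bracket_same_sign[OF Cons.IH[OF False], of x]
      by (simp add: root_word_Cons[OF False] algebra_simps)
    then have 5: "fscale ?k (fbracket (mono_elt ?gx) (fbracket (mono_elt ?gy) (mono_elt ?r))) \<in> ?V"
      by (rule sub)
    have "fbracket (mono_elt ?gy) (mono_elt (root_word s (x # xs))) =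
       (fbracket (mono_elt ?gy) (fbracket (mono_elt ?gx) (mono_elt ?r))
       - fbracket (fbracket (mono_elt ?gy) (mono_elt ?gx)) (mono_elt ?r)
       - fscale ?k (fbracket (mono_elt ?gx) (fbracket (mono_elt ?gy) (mono_elt ?r))))
       + (fbracket (fbracket (mono_elt ?gy) (mono_elt ?gx)) (mono_elt ?r) - fbracket (gen_h c) (mono_elt ?r))
       + (fbracket (gen_h c) (mono_elt ?r) - fscale ?d (mono_elt ?r)) + fscale ?d (mono_elt ?r)
       + fscale ?k (fbracket (mono_elt ?gx) (fbracket (mono_elt ?gy) (mono_elt ?r)))"
      by (simp add: root_word_Cons[OF False])
    also have "\<dots> \<in> ?V"
      by (intro sub(1) 4 5 subsetD[OF K_subset_signed 1] subsetD[OF K_subset_signed 2] subsetD[OF K_subset_signed 3])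
    finally show ?thesis .
  qed
qed

lemma weight_space_gen_h: "gen_h h \<in> weight_space (\<lambda>y. 0)"
  by (rule subsetD[OF signed_space_subset gen_h_in_signed])

lemma weight_space_root_word:
  "xs \<noteq> [] \<Longrightarrow> mono_elt (root_word s xs) \<in> weight_space (weight (root_word s xs :: ('x, 'h) monomial))"
  by (rule subsetD[OF signed_space_subset root_word_in_signed]) auto

lemma bracket_generator:
  assumes "r \<in> weight_space n"
  shows "fbracket (mono_elt (Gen (root_generator s x))) r
    \<in> weight_space (\<lambda>y. n y + generator_weight (root_generator s x :: ('x, 'h) generator) y)"
  using assms weight_subspace
proof (rule weight_space_induct)
  fix s' xs assume xs: "xs \<noteq> []" "weight (root_word s' xs :: ('x, 'h) monomial) = n"
  show "fbracket (mono_elt (Gen (root_generator s x))) (mono_elt (root_word s' xs)) \<in> weight_space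
     (\<lambda>y. n y + generator_weight (root_generator s x :: ('x, 'h) generator) y)"
  proof (cases "s' = s")
    case True
    then show ?thesis
      using subsetD[OF signed_space_subset bracket_same_sign[OF root_word_in_signed[OF xs]]] by blast
  next
    case False
    then have "s = (\<not> s')" by auto
    then show ?thesis
      using subsetD[OF signed_space_subset bracket_opposite_sign[OF xs(1), of s' x]] xs(2) by simp
  qed
next
  fix h :: 'h assume "n = (\<lambda>y. 0)"
  then show "fbracket (mono_elt (Gen (root_generator s x))) (gen_h h) \<in> weight_space
     (\<lambda>y. n y + generator_weight (root_generator s x :: ('x, 'h) generator) y)"
    using subsetD[OF signed_space_subset bracket_same_sign[OF gen_h_in_signed]] by simp
qed (rule subsetD[OF K_subset_weight K_bracket(2)])

lemma bracket_cartan: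
  assumes "r \<in> weight_space n"
  shows "fbracket (gen_h h) r \<in> weight_space n"
  using assms weight_subspace
proof (rule weight_space_induct)
  fix s xs assume xs: "xs \<noteq> []" "weight (root_word s xs :: ('x, 'h) monomial) = n"
  let ?w = "root_word s xs :: ('x, 'h) monomial"
  have "(fbracket (gen_h h) (mono_elt ?w) - fscale (root_sum v (weight ?w) h) (mono_elt ?w))
     + fscale (root_sum v (weight ?w) h) (mono_elt ?w) \<in> weight_space n"
    using weight_space_root_word[OF xs(1), of s] xs(2)
    by (intro free_alg.subspace_add[OF weight_subspace] free_alg.subspace_scale[OF weight_subspace]
         subsetD[OF K_subset_weight cartan_bracket_mono_elt]) simp
  then show "fbracket (gen_h h) (mono_elt ?w) \<in> weight_space n" by simp
next
  fix k :: 'h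
  show "fbracket (gen_h h) (gen_h k) \<in> weight_space n"
    by (rule subsetD[OF K_subset_weight]) (rule subsetD[OF relators_subset relators.H_H])
qed (rule subsetD[OF K_subset_weight K_bracket(2)])

text \<open>A bracket acts as the supercommutator of the actions of its parts. The third argument is
  a monomial because the Jacobi relators take homogeneous elements.\<close>

lemma bracket_jacobi:
  assumes st: "\<And>n r. r \<in> weight_space n \<Longrightarrow> fbracket (mono_elt s) r \<in> weight_space (\<lambda>y. n y + weight s y)"
    "\<And>n r. r \<in> weight_space n \<Longrightarrow> fbracket (mono_elt t) r \<in> weight_space (\<lambda>y. n y + weight t y)"
    and m: "mono_elt m \<in> weight_space n"
  shows "fbracket (mono_elt (Br s t)) (mono_elt m) \<in> weight_space (\<lambda>y. n y + weight (Br s t) y)"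
proof -
  let ?k = "koszul (monomial_parity v s) (monomial_parity v t)"
  have 1: "fbracket (mono_elt s) (fbracket (mono_elt t) (mono_elt m)) \<in> weight_space (\<lambda>y. n y + weight (Br s t) y)"
    using st(1)[OF st(2)[OF m]] by (simp add: algebra_simps)
  have 2: "fbracket (mono_elt t) (fbracket (mono_elt s) (mono_elt m)) \<in> weight_space (\<lambda>y. n y + weight (Br s t) y)"
    using st(2)[OF st(1)[OF m]] by (simp add: algebra_simps)
  have "fbracket (mono_elt (Br s t)) (mono_elt m) =
     fbracket (mono_elt s) (fbracket (mono_elt t) (mono_elt m))
     - fscale ?k (fbracket (mono_elt t) (fbracket (mono_elt s) (mono_elt m)))
     - (fbracket (mono_elt s) (fbracket (mono_elt t) (mono_elt m)) - fbracket (fbracket (mono_elt s) (mono_elt t)) (mono_elt m)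
     - fscale ?k (fbracket (mono_elt t) (fbracket (mono_elt s) (mono_elt m))))"
    by simp
  also have "\<dots> \<in> weight_space (\<lambda>y. n y + weight (Br s t) y)"
    by (intro free_alg.subspace_diff[OF weight_subspace] free_alg.subspace_scale[OF weight_subspace] 1 2
         subsetD[OF K_subset_weight jacobi])
  finally show ?thesis .
qed

lemma bracket_weight_space:
  "r \<in> weight_space n \<Longrightarrow> fbracket (mono_elt t) r \<in> weight_space (\<lambda>y. n y + weight t y)"
proof (induction t arbitrary: n r)
  case (Gen g)
  show ?case
  proof (cases g)
    case (Cart h)
    then show ?thesis using bracket_cartan[OF Gen] by (simp add: gen_h_def)
  next
    case (RootE x)
    then show ?thesis using bracket_generator[OF Gen, of True x] by simp
  next
    case (RootF x)
    then show ?thesis using bracket_generator[OF Gen, of False x] by simp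
  qed
next
  case (Br s t)
  from Br.prems weight_subspace show ?case
  proof (rule weight_space_induct)
    fix s' xs assume xs: "xs \<noteq> []" "weight (root_word s' xs :: ('x, 'h) monomial) = n"
    show "fbracket (mono_elt (Br s t)) (mono_elt (root_word s' xs)) \<in> weight_space (\<lambda>y. n y + weight (Br s t) y)"
      using weight_space_root_word[OF xs(1), of s'] unfolding xs(2) by (rule bracket_jacobi[rotated 2]) (erule Br.IH)+
  next
    fix h :: 'h assume "n = (\<lambda>y. 0)"
    then have "mono_elt (Gen (Cart h)) \<in> weight_space n"
      using weight_space_gen_h[of h] by (simp add: gen_h_def)
    then show "fbracket (mono_elt (Br s t)) (gen_h h) \<in> weight_space (\<lambda>y. n y + weight (Br s t) y)"
      unfolding gen_h_def by (rule bracket_jacobi[rotated 2]) (erule Br.IH)+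
  qed (rule subsetD[OF K_subset_weight K_bracket(2)])
qed

text \<open>In a bracket the left factor acts on the weight space of the right one. Consequently
  every monomial reduces modulo \<open>K\<close> to words of one sign and Cartan elements.\<close>

lemma mono_elt_in_weight_space: "mono_elt t \<in> weight_space (weight t)"
proof (induction t)
  case (Gen g)
  show ?case
  proof (cases g)
    case (Cart h)
    then show ?thesis using weight_space_gen_h[of h] by (simp add: gen_h_def fun_eq_iff cong: if_cong)
  next
    case (RootE x)
    then show ?thesis using weight_space_root_word[of "[x]" True] by (simp del: generator_weight.simps)
  next
    case (RootF x)
    then show ?thesis using weight_space_root_word[of "[x]" False] by (simp del: generator_weight.simps)
  qed
next
  case (Br s t)
  show ?case using bracket_weight_space[OF Br.IH(2), of s] by (simp add: add.commute)
qed

section \<open>Separating weights by the action of the Cartan part\<close>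

lemma cartan_bracket_weight_space:
  assumes "r \<in> weight_space n"
  shows "fbracket (gen_h h) r - fscale (root_sum v n h) r \<in> K"
proof -
  let ?W = "{r. fbracket (gen_h h) r - fscale (root_sum v n h) r \<in> K}"
  have "free_alg.subspace ?W"
  proof (rule free_alg.subspaceI)
    fix a b assume "a \<in> ?W" "b \<in> ?W"
    then have "(fbracket (gen_h h) a - fscale (root_sum v n h) a) + (fbracket (gen_h h) b - fscale (root_sum v n h) b) \<in> K"
      by (simp add: K_add)
    then show "a + b \<in> ?W" by (simp add: fbracket_add_right free_alg.scale_right_distrib algebra_simps)
  next
    fix c a assume "a \<in> ?W"
    then have "fscale c (fbracket (gen_h h) a - fscale (root_sum v n h) a) \<in> K"
      by (simp add: K_scale)
    then show "fscale c a \<in> ?W"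
      by (simp add: fbracket_scale_right free_alg.scale_right_diff_distrib mult.commute)
  qed (simp add: K_zero)
  moreover have "u \<in> ?W" if u: "u \<in> K" for u
    using K_diff[OF K_bracket(2)[OF u] K_scale[OF u]] by simp
  moreover have "mono_elt (root_word s xs) \<in> ?W"
    if "weight (root_word s xs :: ('x, 'h) monomial) = n" for s xs
    using cartan_bracket_mono_elt[of h "root_word s xs"] that by simp
  moreover have "gen_h k \<in> ?W" if "n = (\<lambda>y. 0)" for k
    using subsetD[OF relators_subset relators.H_H, of h k] that by simp
  ultimately have "r \<in> ?W"
    using assms unfolding weight_space_def by (intro free_alg.span_induct[of r _ "\<lambda>r. r \<in> ?W"]) auto
  then show ?thesis by simp
qed

text \<open>Choosing \<open>c\<close> as the value of one weight at \<open>h\<close> removes that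
  summand and rescales the others, which is the elimination step below.\<close>

lemma cartan_bracket_sum:
  assumes "\<And>n. n \<in> F \<Longrightarrow> r n \<in> weight_space n"
  shows "(fbracket (gen_h h) (\<Sum>n\<in>F. r n) - fscale c (\<Sum>n\<in>F. r n))
      - (\<Sum>n\<in>F. fscale (root_sum v n h - c) (r n)) \<in> K"
proof -
  have "(\<Sum>n\<in>F. fbracket (gen_h h) (r n) - fscale (root_sum v n h) (r n)) \<in> K"
    using assms by (intro K_sum cartan_bracket_weight_space)
  then show ?thesis
    by (simp add: fbracket_sum_right free_alg.scale_sum_right free_alg.scale_left_diff_distrib sum_subtractf algebra_simps)
qed

lemma K_scale_cancel: "fscale c u \<in> K \<Longrightarrow> c \<noteq> 0 \<Longrightarrow> u \<in> K"
  using K_scale[of "fscale c u" "inverse c"] by simp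

text \<open>Weight spaces form a direct sum modulo \<open>K\<close>. For each remaining weight some
  \<open>h\<close> distinguishes it from the weight \<open>m\<close>; eliminating \<open>m\<close>
  with this \<open>h\<close> leaves a nonzero multiple of the wanted summand.\<close>

lemma weight_sum_in_K:
  assumes "finite F" "\<And>n. n \<in> F \<Longrightarrow> r n \<in> weight_space n" "(\<Sum>n\<in>F. r n) \<in> K" "n \<in> F"
  shows "r n \<in> K"
  using assms
proof (induction F arbitrary: r n rule: finite_induct)
  case empty
  then show ?case by simp
next
  case (insert m F)
  have others: "r k \<in> K" if k: "k \<in> F" for k
  proof -
    have "root_sum v m \<noteq> root_sum v k"
      using root_sum_eq_iff[OF valid] insert.hyps(2) k by metis
    then obtain h where "root_sum v m h \<noteq> root_sum v k h" by (auto simp: fun_eq_iff)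
    then have h: "root_sum v k h - root_sum v m h \<noteq> 0" by simp
    let ?z = "\<Sum>n\<in>insert m F. r n"
    let ?c = "root_sum v m h"
    have 1: "fbracket (gen_h h) ?z - fscale ?c ?z \<in> K"
      by (intro K_diff K_bracket K_scale insert.prems)
    have 2: "(fbracket (gen_h h) ?z - fscale ?c ?z) - (\<Sum>n\<in>insert m F. fscale (root_sum v n h - ?c) (r n)) \<in> K"
      using insert.prems by (intro cartan_bracket_sum) auto
    have "(\<Sum>n\<in>insert m F. fscale (root_sum v n h - ?c) (r n)) \<in> K"
      using K_diff[OF 1 2] by simp
    then have "(\<Sum>n\<in>F. fscale (root_sum v n h - ?c) (r n)) \<in> K"
      using insert.hyps by simp
    then have "fscale (root_sum v k h - ?c) (r k) \<in> K"
      using insert.prems(1) k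
      by (intro insert.IH[of "\<lambda>n. fscale (root_sum v n h - ?c) (r n)"])
        (auto intro: free_alg.subspace_scale[OF weight_subspace])
    then show ?thesis using h K_scale_cancel by blast
  qed
  have "(\<Sum>n\<in>F. r n) \<in> K" using others by (rule K_sum)
  then have "(\<Sum>n\<in>insert m F. r n) - (\<Sum>n\<in>F. r n) \<in> K"
    using insert.prems by (intro K_diff)
  then have "r m \<in> K" using insert.hyps by simp
  then show ?case using others insert.prems by blast
qed

lemma weight_decomposition:
  obtains F r where "finite F" "\<And>n. n \<in> F \<Longrightarrow> r n \<in> weight_space n" "w = (\<Sum>n\<in>F. r n)"
proof
  let ?S = "Poly_Mapping.keys w"
  let ?r = "\<lambda>n. \<Sum>t\<in>{t \<in> ?S. weight t = n}. fscale (Poly_Mapping.lookup w t) (mono_elt t)"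
  show "finite (weight ` ?S)" by simp
  show "?r n \<in> weight_space n" for n
    by (intro free_alg.subspace_sum[OF weight_subspace] free_alg.subspace_scale[OF weight_subspace])
      (auto intro: mono_elt_in_weight_space)
  show "w = (\<Sum>n\<in>weight ` ?S. ?r n)"
    using poly_mapping_sum_mono_elt[of w] by (subst sum.group) auto
qed

text \<open>The image of a generator under an isomorphism is known only as a common eigenvector of
  the Cartan part. This places it, modulo the ideal, in a single weight space.\<close>

lemma eigenvector_weight:
  assumes w: "w \<notin> K" and eigen: "\<And>h. fbracket (gen_h h) w - fscale (\<mu> h) w \<in> K"
  obtains n r where "\<mu> = root_sum v n" "r \<in> weight_space n" "r \<notin> K" "w - r \<in> K"
proof -
  obtain F r where F: "finite F" and r: "\<And>n. n \<in> F \<Longrightarrow> r n \<in> weight_space n" and w_eq: "w = (\<Sum>n\<in>F. r n)"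
    by (rule weight_decomposition[of w]) blast
  have K: "fscale (root_sum v n h - \<mu> h) (r n) \<in> K" if "n \<in> F" for n h
  proof -
    have "(fbracket (gen_h h) w - fscale (\<mu> h) w) - (\<Sum>n\<in>F. fscale (root_sum v n h - \<mu> h) (r n)) \<in> K"
      unfolding w_eq using r by (rule cartan_bracket_sum)
    from K_diff[OF eigen[of h] this] have "(\<Sum>n\<in>F. fscale (root_sum v n h - \<mu> h) (r n)) \<in> K"
      by simp
    then show ?thesis
      using r that
      by (intro weight_sum_in_K[OF F, where r = "\<lambda>n. fscale (root_sum v n h - \<mu> h) (r n)"])
        (auto intro: free_alg.subspace_scale[OF weight_subspace])
  qed
  have "\<exists>n\<in>F. r n \<notin> K"
    using w K_sum[of F r] unfolding w_eq by blast
  then obtain n where n: "n \<in> F" "r n \<notin> K" by blast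
  have mu: "\<mu> = root_sum v n"
    using K[OF n(1)] K_scale_cancel n(2) by (metis eq_iff_diff_eq_0 ext)
  have "r m \<in> K" if m: "m \<in> F - {n}" for m
  proof -
    have "root_sum v m \<noteq> \<mu>" using root_sum_eq_iff[OF valid] m mu by auto
    then obtain h where "root_sum v m h - \<mu> h \<noteq> 0" by (auto simp: fun_eq_iff)
    then show ?thesis using K[of m h] m K_scale_cancel by blast
  qed
  then have "(\<Sum>m\<in>F - {n}. r m) \<in> K" by (rule K_sum)
  then have "w - r n \<in> K"
    unfolding w_eq using F n(1) by (simp add: sum_diff1)
  then show thesis using that[OF mu r[OF n(1)] n(2)] by blast
qed

lemma weight_root_word:
  "xs \<noteq> [] \<Longrightarrow> weight (root_word s xs :: ('x, 'h) monomial) y =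
    (if s then int (count_list xs y) else - int (count_list xs y))"
proof (induction xs)
  case (Cons x xs)
  then show ?case
    by (cases "xs = []"; cases s) (auto simp: root_word_Cons)
qed simp

text \<open>A weight with coefficients of both signs is neither zero nor the weight of a one-sign
  word, so only \<open>K\<close> is left in the spanning set.\<close>

lemma weight_space_coherent:
  assumes "r \<in> weight_space n" "r \<notin> K"
  shows "(\<forall>y. 0 \<le> n y) \<or> (\<forall>y. n y \<le> 0)"
proof (rule ccontr)
  assume n: "\<not> ?thesis"
  have "n \<noteq> weight (root_word s xs :: ('x, 'h) monomial)" if "xs \<noteq> []" for s xs
    using n weight_root_word[OF that, of s] by (cases s) auto
  moreover have "n \<noteq> (\<lambda>y. 0)" using n by auto
  ultimately have "r \<in> free_alg.span K"
    using assms(1) unfolding weight_space_def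
    by (rule_tac subsetD[OF free_alg.span_mono]) auto
  then show False using assms(2) free_alg.span_minimal[OF order_refl subspace_K] by blast
qed

text \<open>The weight of a word counts its letters with a sign, so a word whose weight is that of a
  generator consists of this single letter.\<close>

lemma simple_weight_space:
  assumes "r \<in> weight_space (generator_weight (root_generator s y :: ('x, 'h) generator))"
  obtains c where "r - fscale c (mono_elt (Gen (root_generator s y))) \<in> K"
proof -
  let ?g = "mono_elt (Gen (root_generator s y)) :: ('x, 'h) free_algebra"
  let ?n = "generator_weight (root_generator s y :: ('x, 'h) generator)"
  let ?W = "{r. \<exists>c. r - fscale c ?g \<in> K}"
  have "free_alg.subspace ?W"
  proof (rule free_alg.subspaceI)
    show "0 \<in> ?W" using K_zero by (auto intro: exI[of _ 0])
  next
    fix a b assume "a \<in> ?W" "b \<in> ?W"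
    then obtain c d where "a - fscale c ?g \<in> K" "b - fscale d ?g \<in> K" by blast
    from K_add[OF this] have "a + b - fscale (c + d) ?g \<in> K"
      by (simp add: algebra_simps flip: single_add)
    then show "a + b \<in> ?W" by blast
  next
    fix d a assume "a \<in> ?W"
    then obtain c where "a - fscale c ?g \<in> K" by blast
    from K_scale[OF this, of d] have "fscale d a - fscale (d * c) ?g \<in> K"
      by (simp add: free_alg.scale_right_diff_distrib)
    then show "fscale d a \<in> ?W" by blast
  qed
  moreover have "u \<in> ?W" if "u \<in> K" for u
    using that by (auto intro!: exI[of _ 0])
  moreover have "mono_elt (root_word s' xs) \<in> ?W"
    if xs: "xs \<noteq> []" "weight (root_word s' xs :: ('x, 'h) monomial) = ?n" for s' xs
  proof -
    have eq: "(if s' then int (count_list xs z) else - int (count_list xs z)) = ?n z" for z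
      using xs weight_root_word by metis
    have ss: "s' = s" using eq[of y] by (cases s; cases s') auto
    have cnt: "count_list xs z = (if z = y then 1 else 0)" for z
      using eq[of z] ss by (cases s) (auto split: if_splits)
    obtain x xs' where xs': "xs = x # xs'" using xs(1) by (cases xs) auto
    have x: "x = y" using cnt[of x] xs' by (auto split: if_splits)
    have "count_list xs' z = 0" for z using cnt[of z] x xs' by (auto split: if_splits)
    then have "xs' = []" by (metis count_list_0_iff list.set_intros(1) neq_Nil_conv)
    then show ?thesis using xs' x ss K_zero by (auto intro!: exI[of _ 1])
  qed
  moreover have "?n \<noteq> (\<lambda>z. 0)" by (cases s) (auto simp: fun_eq_iff)
  ultimately have "r \<in> ?W"
    using assms unfolding weight_space_def by (intro free_alg.span_induct[of r _ "\<lambda>r. r \<in> ?W"]) auto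
  then show thesis using that by blast
qed

text \<open>Otherwise \<open>K\<close> would contain the bracket of \<open>gen_e x\<close> and
  \<open>gen_f x\<close>, hence the coroot, which is nonzero by linear independence.\<close>

lemma generator_notin: "mono_elt (Gen (root_generator s x)) \<notin> K"
proof
  assume g: "mono_elt (Gen (root_generator s x)) \<in> K"
  have "fbracket (gen_e x) (gen_f x) \<in> K"
    using K_bracket(1)[OF g, of "gen_f x"] K_bracket(2)[OF g, of "gen_e x"]
    by (cases s) (auto simp: gen_e_def gen_f_def)
  moreover have "fbracket (gen_e x) (gen_f x) - gen_h (coroot_a v x) \<in> K"
    by (rule subsetD[OF relators_subset relators.E_F_same])
  ultimately have "gen_h (coroot_a v x) \<in> K" using K_diff by fastforce
  then have "coroot_a v x = 0" by (rule gen_h_eq_zero)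
  then have "(\<Sum>y\<in>UNIV. (if y = x then 1 else 0) *\<^sub>C coroot_a v y) = 0"
    by (intro sum.neutral) auto
  from coroot_a_independent[OF valid this, of x] show False by simp
qed

lemma cls_eq_iff: "cls K u = cls K w \<longleftrightarrow> u - w \<in> K"
proof
  assume "cls K u = cls K w"
  moreover have "u \<in> cls K u" by (simp add: cls_def K_zero)
  ultimately show "u - w \<in> K" by (auto simp: cls_def)
next
  assume *: "u - w \<in> K"
  have "z - u \<in> K \<longleftrightarrow> z - w \<in> K" for z
    using K_add[OF _ *, of "z - u"] K_diff[OF _ *, of "z - w"] by (auto simp: algebra_simps)
  then show "cls K u = cls K w" by (auto simp: cls_def)
qed

end

section \<open>Transport through an isomorphism that fixes the Cartan part\<close>

locale half_baked_isomorphism =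
  A: half_baked v K + B: half_baked v' K'
  for v :: "('x::finite, 'h::fin_dim_complex_vector) root_datum" and K
    and v' :: "('x, 'h) root_datum" and K' +
  fixes \<phi>
  assumes iso: "quotient_isomorphism v K v' K' \<phi>"
    and iso_h: "\<phi> (cls K (gen_h h)) = cls K' (gen_h h)"
begin

lemma iso_bij: "bij_betw \<phi> (range (cls K)) (range (cls K'))"
  by (rule conjunct1[OF iso[unfolded quotient_isomorphism_def]])

lemma iso_image: obtains u' where "\<phi> (cls K u) = cls K' u'"
proof -
  have "\<phi> (cls K u) \<in> range (cls K')"
    by (rule bij_betw_apply[OF iso_bij rangeI])
  then show thesis using that by blast
qed

lemma iso_ops:
  assumes "\<phi> (cls K u) = cls K' u'" "\<phi> (cls K w) = cls K' w'"
  shows "\<phi> (cls K (u + w)) = cls K' (u' + w')" "\<phi> (cls K (fscale c u)) = cls K' (fscale c u')"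
    "\<phi> (cls K (fbracket u w)) = cls K' (fbracket u' w')"
  using iso[unfolded quotient_isomorphism_def, THEN conjunct2, THEN conjunct1, rule_format, OF conjI[OF assms]]
  by simp_all

lemma iso_mem:
  assumes "\<phi> (cls K u) = cls K' u'"
  shows "u \<in> K \<longleftrightarrow> u' \<in> K'"
proof -
  have z: "\<phi> (cls K 0) = cls K' 0"
    using iso_ops(2)[OF assms assms, of 0] by simp
  have "u \<in> K \<longleftrightarrow> cls K u = cls K 0" by (simp add: A.cls_eq_iff)
  also have "\<dots> \<longleftrightarrow> \<phi> (cls K u) = \<phi> (cls K 0)"
    by (rule inj_on_eq_iff[OF bij_betw_imp_inj_on[OF iso_bij] rangeI rangeI, symmetric])
  also have "\<dots> \<longleftrightarrow> u' \<in> K'" by (simp add: z assms B.cls_eq_iff)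
  finally show ?thesis .
qed

text \<open>Since \<open>\<phi>\<close> fixes the Cartan part, the eigenvalue equation of a
  generator carries over to its image, which \<open>eigenvector_weight\<close> then locates.\<close>

lemma iso_generator:
  assumes "\<phi> (cls K (mono_elt (Gen (root_generator s x)))) = cls K' w"
  obtains n r where
    "root_sum v (generator_weight (root_generator s x :: ('x, 'h) generator)) = root_sum v' n"
    "r \<in> B.weight_space n" "r \<notin> K'" "w - r \<in> K'"
proof (rule B.eigenvector_weight)
  show "w \<notin> K'" using iso_mem[OF assms] A.generator_notin by blast
next
  fix h
  let ?g = "mono_elt (Gen (root_generator s x)) :: ('x, 'h) free_algebra"
  let ?c = "root_sum v (generator_weight (root_generator s x :: ('x, 'h) generator)) h"
  have "fbracket (gen_h h) ?g - fscale ?c ?g \<in> K"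
    using A.cartan_bracket_mono_elt[of h "Gen (root_generator s x)"] by simp
  \<comment> \<open>The difference is written as a sum because \<open>\<phi>\<close> is specified on
    sums, scalar multiples and brackets.\<close>
  then have "fbracket (gen_h h) ?g + fscale (- ?c) ?g \<in> K" by (simp add: single_uminus)
  moreover have "\<phi> (cls K (fbracket (gen_h h) ?g + fscale (- ?c) ?g)) =
      cls K' (fbracket (gen_h h) w + fscale (- ?c) w)"
    by (rule iso_ops(1)[OF iso_ops(3)[OF iso_h assms] iso_ops(2)[OF assms assms]])
  ultimately show "fbracket (gen_h h) w - fscale ?c w \<in> K'"
    using iso_mem by fastforce
qed

lemma root_b_coherent:
  obtains n where "root_b v x = root_sum v' n" "(\<forall>y. 0 \<le> n y) \<or> (\<forall>y. n y \<le> 0)"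
proof -
  obtain w where w: "\<phi> (cls K (mono_elt (Gen (root_generator True x)))) = cls K' w"
    by (rule iso_image)
  obtain n r where nr: "root_sum v (generator_weight (root_generator True x :: ('x, 'h) generator)) = root_sum v' n"
    "r \<in> B.weight_space n" "r \<notin> K'" "w - r \<in> K'"
    using w by (rule iso_generator)
  have "root_b v x = root_sum v' n"
  proof
    fix h show "root_b v x h = root_sum v' n h"
      using fun_cong[OF nr(1), of h] unfolding generator_root_sum by simp
  qed
  then show thesis using that B.weight_space_coherent[OF nr(2,3)] by blast
qed

lemma iso_simple_generator:
  assumes "root_b v x = root_b v' y"
  obtains c where "\<phi> (cls K (mono_elt (Gen (root_generator s x)))) =
      cls K' (fscale c (mono_elt (Gen (root_generator s y))))"
proof -
  obtain w where w: "\<phi> (cls K (mono_elt (Gen (root_generator s x)))) = cls K' w"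
    by (rule iso_image)
  obtain n r where nr: "root_sum v (generator_weight (root_generator s x :: ('x, 'h) generator)) = root_sum v' n"
    "r \<in> B.weight_space n" "r \<notin> K'" "w - r \<in> K'"
    using w by (rule iso_generator)
  have "root_sum v' (generator_weight (root_generator s y :: ('x, 'h) generator)) = root_sum v' n"
    using nr(1) assms unfolding fun_eq_iff generator_root_sum by simp
  then have "n = generator_weight (root_generator s y :: ('x, 'h) generator)"
    using root_sum_eq_iff[OF B.valid] by metis
  then obtain c where "r - fscale c (mono_elt (Gen (root_generator s y))) \<in> K'"
    using nr(2) B.simple_weight_space by blast
  from B.K_add[OF nr(4) this]
  have "w - fscale c (mono_elt (Gen (root_generator s y))) \<in> K'" by simp
  then show thesis using that w B.cls_eq_iff by metis
qed

text \<open>Both generators are sent to multiples of the corresponding generators. The image of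
  their bracket is thus a multiple of the target coroot, while \<open>\<phi>\<close> fixes the
  source coroot.\<close>

lemma coroot_proportional:
  assumes "root_b v x = root_b v' y"
  obtains c where "coroot_a v x = c *\<^sub>C coroot_a v' y"
proof -
  obtain c where c: "\<phi> (cls K (gen_e x)) = cls K' (fscale c (gen_e y))"
    using iso_simple_generator[OF assms, of True] by (auto simp: gen_e_def)
  obtain d where d: "\<phi> (cls K (gen_f x)) = cls K' (fscale d (gen_f y))"
    using iso_simple_generator[OF assms, of False] by (auto simp: gen_f_def)
  have "cls K (gen_h (coroot_a v x)) = cls K (fbracket (gen_e x) (gen_f x))"
    using A.K_neg[OF subsetD[OF A.relators_subset relators.E_F_same[of x v]]] by (simp add: A.cls_eq_iff)
  then have "cls K' (gen_h (coroot_a v x)) = cls K' (fbracket (fscale c (gen_e y)) (fscale d (gen_f y)))"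
    using iso_ops(3)[OF c d] iso_h by metis
  then have 1: "gen_h (coroot_a v x) - fscale (c * d) (fbracket (gen_e y) (gen_f y)) \<in> K'"
    by (simp add: B.cls_eq_iff fbracket_scale_left fbracket_scale_right mult.commute)
  have 2: "fscale (c * d) (fbracket (gen_e y) (gen_f y) - gen_h (coroot_a v' y)) \<in> K'"
    by (rule B.K_scale[OF subsetD[OF B.relators_subset relators.E_F_same]])
  let ?h = "coroot_a v x" and ?k = "(c * d) *\<^sub>C coroot_a v' y"
  have 3: "gen_h ?k - fscale (c * d) (gen_h (coroot_a v' y)) \<in> K'"
    by (rule subsetD[OF B.relators_subset relators.H_scale])
  have "gen_h ?h - gen_h ?k \<in> K'"
    using B.K_diff[OF B.K_add[OF 1 2] 3] by (simp add: free_alg.scale_right_diff_distrib)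
  \<comment> \<open>\<open>gen_h\<close> is additive only modulo the ideal, so the difference has to
    be moved inside it before \<open>gen_h_eq_zero\<close> applies.\<close>
  moreover have "gen_h ((?h - ?k) + ?k) - (gen_h (?h - ?k) + gen_h ?k) \<in> K'"
    by (rule subsetD[OF B.relators_subset relators.H_add])
  ultimately have "(gen_h ?h - gen_h ?k) - (gen_h ((?h - ?k) + ?k) - (gen_h (?h - ?k) + gen_h ?k)) \<in> K'"
    by (rule B.K_diff)
  then have "gen_h (?h - ?k) \<in> K'" by simp
  then show thesis using that B.gen_h_eq_zero by (metis eq_iff_diff_eq_0)
qed

end

section \<open>Reflexions and arrows\<close>

lemma cfunctional_simps:
  assumes "cfunctional f"
  shows "f (h + k) = f h + f k" "f (c *\<^sub>C h) = c * f h" "f (h - k) = f h - f k" "f (- h) = - f h" "f 0 = 0"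
proof -
  interpret Vector_Spaces.linear scaleC "(*)" f by fact
  show "f (h + k) = f h + f k" "f (c *\<^sub>C h) = c * f h" "f (h - k) = f h - f k" "f (- h) = - f h" "f 0 = 0"
    by (rule add scale diff neg zero)+
qed

lemma clinear_simps:
  assumes "clinear f"
  shows "f (h + k) = f h + f k" "f (c *\<^sub>C h) = c *\<^sub>C f h" "f (h - k) = f h - f k" "f (- h) = - f h" "f 0 = 0"
proof -
  interpret Vector_Spaces.linear scaleC scaleC f by fact
  show "f (h + k) = f h + f k" "f (c *\<^sub>C h) = c *\<^sub>C f h" "f (h - k) = f h - f k" "f (- h) = - f h" "f 0 = 0"
    by (rule add scale diff neg zero)+
qed

lemma cfunctionalI:
  "(\<And>h k. f (h + k) = f h + f k) \<Longrightarrow> (\<And>c h. f (c *\<^sub>C h) = c * f h) \<Longrightarrow> cfunctional f"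
  by unfold_locales (auto simp: algebra_simps)

lemma clinearI:
  "(\<And>h k. f (h + k) = f h + f k) \<Longrightarrow> (\<And>c h. f (c *\<^sub>C h) = c *\<^sub>C f h) \<Longrightarrow> clinear f"
  by unfold_locales auto

lemma valid_cfunctional: "valid_root_datum v \<Longrightarrow> cfunctional (root_b v x)"
  unfolding valid_root_datum_def by blast

lemmas root_b_simps = cfunctional_simps[OF valid_cfunctional]

section \<open>Validity and involutivity of reflexions\<close>

lemma sum_shift:
  fixes d k g :: "'x::finite \<Rightarrow> complex"
  shows "(\<Sum>y\<in>UNIV. d y * (g y + k y * g x)) =
    (\<Sum>y\<in>UNIV. (d y + (if y = x then \<Sum>z\<in>UNIV. d z * k z else 0)) * g y)"
proof -
  have "(\<Sum>y\<in>UNIV. (if y = x then \<Sum>z\<in>UNIV. d z * k z else 0) * g y) = (\<Sum>z\<in>UNIV. d z * k z) * g x"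
    by (simp add: if_distrib[where f = "\<lambda>c. c * g _"] cong: if_cong)
  then show ?thesis
    by (simp add: distrib_left distrib_right sum.distrib sum_distrib_right mult.assoc)
qed

lemma sum_shift_vector:
  fixes d k :: "'x::finite \<Rightarrow> complex" and g :: "'x \<Rightarrow> 'h::complex_vector"
  shows "(\<Sum>y\<in>UNIV. d y *\<^sub>C (g y + k y *\<^sub>C g x)) =
    (\<Sum>y\<in>UNIV. (d y + (if y = x then \<Sum>z\<in>UNIV. d z * k z else 0)) *\<^sub>C g y)"
proof -
  have "(\<Sum>y\<in>UNIV. (if y = x then \<Sum>z\<in>UNIV. d z * k z else 0) *\<^sub>C g y) = (\<Sum>z\<in>UNIV. d z * k z) *\<^sub>C g x"
    by (simp add: if_distrib[where f = "\<lambda>c. c *\<^sub>C g _"] cong: if_cong)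
  then show ?thesis
    by (simp add: scaleC_add_left scaleC_add_right sum.distrib cvec.scale_sum_left scaleC_scaleC)
qed

text \<open>Coefficients off \<open>x\<close> are unchanged and hence vanish; the one at
  \<open>x\<close> then becomes \<open>d x - 2 * d x\<close>, which is \<open>- d x\<close>.\<close>

lemma shift_coeff_zero:
  fixes d k :: "'x::finite \<Rightarrow> complex"
  assumes "k x = - 2" "\<And>y. d y + (if y = x then \<Sum>z\<in>UNIV. d z * k z else 0) = 0"
  shows "d y = 0"
proof -
  have off: "d z = 0" if "z \<noteq> x" for z using assms(2)[of z] that by simp
  have "(\<Sum>z\<in>UNIV. d z * k z) = (\<Sum>z\<in>{x}. d z * k z)"
    using off by (intro sum.mono_neutral_right) auto
  then have "d x = 0" using assms(2)[of x] assms(1) by simp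
  then show ?thesis using off by metis
qed

lemma valid_shift:
  assumes v: "valid_root_datum v" and kl: "k x = - 2" "l x = - 2"
    and a: "\<And>y. coroot_a v' y = coroot_a v y + k y *\<^sub>C coroot_a v x"
    and b: "\<And>y h. root_b v' y h = root_b v y h + l y * root_b v x h"
  shows "valid_root_datum v'"
  unfolding valid_root_datum_def
proof (intro conjI allI impI)
  show "cfunctional (root_b v' y)" for y
    by (rule cfunctionalI) (simp_all add: b root_b_simps[OF v] algebra_simps)
next
  fix d y assume "(\<Sum>x\<in>UNIV. d x *\<^sub>C coroot_a v' x) = 0"
  then have "(\<Sum>y\<in>UNIV. (d y + (if y = x then \<Sum>z\<in>UNIV. d z * k z else 0)) *\<^sub>C coroot_a v y) = 0"
    unfolding a sum_shift_vector .
  from coroot_a_independent[OF v this] show "d y = 0"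
    by (rule shift_coeff_zero[where k = k, OF kl(1)])
next
  fix d y assume "\<forall>h. (\<Sum>x\<in>UNIV. d x * root_b v' x h) = 0"
  then have "(\<Sum>y\<in>UNIV. (d y + (if y = x then \<Sum>z\<in>UNIV. d z * l z else 0)) * root_b v y h) = 0" for h
    unfolding b using sum_shift[of d "\<lambda>y. root_b v y h" l x] by simp
  from root_b_independent[OF v this] show "d y = 0"
    by (rule shift_coeff_zero[where k = l, OF kl(2)])
qed

text \<open>Isotropic and anisotropic reflexions get one common form: every vector moves by a
  multiple of the one at \<open>x\<close>. The factor \<open>- 2\<close> at \<open>x\<close> itself
  expresses its change of sign.\<close>

lemma reflexion_shift:
  fixes v :: "('x, 'h::complex_vector) root_datum"
  obtains k l :: "'x \<Rightarrow> complex" where "k x = - 2" "l x = - 2"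
    "\<And>y. coroot_a (reflexion x v) y = coroot_a v y + k y *\<^sub>C coroot_a v x"
    "\<And>y h. root_b (reflexion x v) y h = root_b v y h + l y * root_b v x h"
proof (cases "cartan v x x = 0")
  case True
  have neg: "- w = w + (- 2) *\<^sub>C w" for w :: 'h
    using scaleC_add_left[of 1 "- 2" w] by (simp add: scaleC_one)
  let ?k = "\<lambda>y. if y = x then - 2 else if cartan v x y = 0 then 0 else cartan v y x / cartan v x y"
  let ?l = "\<lambda>y. if y = x then - 2 else if cartan v x y = 0 then 0 else 1"
  show thesis
  proof (rule that[of ?k ?l])
    show "coroot_a (reflexion x v) y = coroot_a v y + ?k y *\<^sub>C coroot_a v x" for y
      using True neg[of "coroot_a v x"] by (simp add: reflexion_def isotropic_reflexion_def)
    show "root_b (reflexion x v) y h = root_b v y h + ?l y * root_b v x h" for y h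
      using True by (simp add: reflexion_def isotropic_reflexion_def)
  qed auto
next
  case False
  show thesis
  proof (rule that[of "\<lambda>y. - (2 * cartan v y x / cartan v x x)" "\<lambda>y. - (2 * cartan v x y / cartan v x x)"])
    show "coroot_a (reflexion x v) y = coroot_a v y + (- (2 * cartan v y x / cartan v x x)) *\<^sub>C coroot_a v x" for y
      using False by (simp add: reflexion_def anisotropic_reflexion_def)
    show "root_b (reflexion x v) y h = root_b v y h + (- (2 * cartan v x y / cartan v x x)) * root_b v x h" for y h
      using False by (simp add: reflexion_def anisotropic_reflexion_def)
  qed (use False in auto)
qed

lemma valid_reflexion: "valid_root_datum v \<Longrightarrow> valid_root_datum (reflexion x v)"
  using reflexion_shift[of x v] valid_shift by metis

text \<open>Row and column \<open>x\<close> suffice, since they determine the next reflexion at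
  \<open>x\<close> and the Cartan conditions for its reflectability.\<close>

lemma cartan_isotropic_reflexion:
  assumes v: "valid_root_datum v" and 0: "cartan v x x = 0"
  shows "cartan (reflexion x v) x y = - cartan v x y" "cartan (reflexion x v) y x = - cartan v y x"
  using 0 unfolding reflexion_def isotropic_reflexion_def
  by (auto simp: cartan_def root_b_simps[OF v])

lemma cartan_anisotropic_reflexion:
  assumes v: "valid_root_datum v" and "cartan v x x \<noteq> 0"
  shows "cartan (reflexion x v) x y = cartan v x y" "cartan (reflexion x v) y x = cartan v y x"
  using assms(2) unfolding reflexion_def anisotropic_reflexion_def
  by (auto simp: cartan_def root_b_simps[OF v] field_simps)

lemma reflectable_reflexion:
  assumes v: "valid_root_datum v" and r: "reflectable v x"
  shows "reflectable (reflexion x v) x"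
proof (cases "cartan v x x = 0")
  case True
  then have "parity (reflexion x v) x = parity v x"
    by (simp add: reflexion_def isotropic_reflexion_def)
  then show ?thesis
    using r True cartan_isotropic_reflexion[OF v True, of x] unfolding reflectable_def by simp
next
  case False
  then have "parity (reflexion x v) x = parity v x"
    by (simp add: reflexion_def anisotropic_reflexion_def)
  then show ?thesis
    using r cartan_anisotropic_reflexion[OF v False] unfolding reflectable_def by simp
qed

lemma reflexion_reflexion:
  assumes v: "valid_root_datum v"
  shows "reflexion x (reflexion x v) = v"
proof (cases "cartan v x x = 0")
  case True
  note c = cartan_isotropic_reflexion[OF v True]
  have "reflexion x (reflexion x v) = isotropic_reflexion x (reflexion x v)"
    unfolding reflexion_def[of x "reflexion x v"] by (simp add: c True)
  also have "\<dots> = v"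
    unfolding isotropic_reflexion_def[of x "reflexion x v"] c
    using True by (auto intro!: root_datum.equality simp: fun_eq_iff reflexion_def isotropic_reflexion_def)
  finally show ?thesis .
next
  case False
  note c = cartan_anisotropic_reflexion[OF v False]
  have "reflexion x (reflexion x v) = anisotropic_reflexion x (reflexion x v)"
    unfolding reflexion_def[of x "reflexion x v"] by (simp add: c False)
  also have "\<dots> = v"
    unfolding anisotropic_reflexion_def[of x "reflexion x v"] c
    using False by (auto intro!: root_datum.equality simp: fun_eq_iff reflexion_def anisotropic_reflexion_def algebra_simps
        simp flip: scaleC_add_left)
  finally show ?thesis .
qed

section \<open>Tautological arrows and chains of reflexions\<close>

lemma tautological_simps [simp]:
  "coroot_a (tautological \<theta> v) x = \<theta> (coroot_a v x)"
  "root_b (tautological \<theta> v) x = root_b v x \<circ> inv_into UNIV \<theta>"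
  "parity (tautological \<theta> v) = parity v"
  by (simp_all add: tautological_def)

lemma cartan_tautological: "bij \<theta> \<Longrightarrow> cartan (tautological \<theta> v) = cartan v"
  by (auto simp: fun_eq_iff cartan_def bij_is_inj)

lemma reflectable_tautological: "bij \<theta> \<Longrightarrow> reflectable (tautological \<theta> v) x = reflectable v x"
  by (simp add: reflectable_def cartan_tautological)

lemma reflexion_tautological:
  assumes "bij \<theta>" "clinear \<theta>"
  shows "reflexion x (tautological \<theta> v) = tautological \<theta> (reflexion x v)"
  using cartan_tautological[OF assms(1), of v]
  by (auto intro!: root_datum.equality
      simp: fun_eq_iff reflexion_def isotropic_reflexion_def anisotropic_reflexion_def clinear_simps[OF assms(2)])

lemma tautological_id [simp]: "tautological id v = v"
  by (rule root_datum.equality) auto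

lemma tautological_compose:
  "bij \<theta> \<Longrightarrow> bij \<eta> \<Longrightarrow> tautological \<theta> (tautological \<eta> v) = tautological (\<theta> \<circ> \<eta>) v"
  by (rule root_datum.equality) (auto simp: fun_eq_iff o_inv_distrib)

lemma clinear_inv: "clinear \<theta> \<Longrightarrow> bij \<theta> \<Longrightarrow> clinear (inv_into UNIV \<theta>)"
  by (rule clinearI) (metis bij_inv_eq_iff clinear_simps(1), metis bij_inv_eq_iff clinear_simps(2))

lemma valid_tautological:
  assumes v: "valid_root_datum v" and \<theta>: "clinear \<theta>" "bij \<theta>"
  shows "valid_root_datum (tautological \<theta> v)"
  unfolding valid_root_datum_def
proof (intro conjI allI impI)
  show "cfunctional (root_b (tautological \<theta> v) x)" for x
    by (rule cfunctionalI) (simp_all add: root_b_simps[OF v] clinear_simps[OF clinear_inv[OF \<theta>]])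
next
  fix c x assume *: "(\<Sum>x\<in>UNIV. c x *\<^sub>C coroot_a (tautological \<theta> v) x) = 0"
  interpret Vector_Spaces.linear scaleC scaleC \<theta> by fact
  have "\<theta> (\<Sum>x\<in>UNIV. c x *\<^sub>C coroot_a v x) = \<theta> 0"
    using * by (simp add: sum scale zero)
  then have "(\<Sum>x\<in>UNIV. c x *\<^sub>C coroot_a v x) = 0"
    using injD[OF bij_is_inj[OF \<theta>(2)]] by blast
  then show "c x = 0" by (rule coroot_a_independent[OF v])
next
  fix c x assume *: "\<forall>h. (\<Sum>x\<in>UNIV. c x * root_b (tautological \<theta> v) x h) = 0"
  have "(\<Sum>x\<in>UNIV. c x * root_b v x h) = 0" for h
    using *[rule_format, of "\<theta> h"] \<theta>(2) by (simp add: bij_is_inj)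
  then show "c x = 0" by (rule root_b_independent[OF v])
qed

lemma valid_homothety:
  assumes v: "valid_root_datum v" and l: "\<And>x. l x \<noteq> 0"
  shows "valid_root_datum (homothety l v)"
  unfolding valid_root_datum_def
proof (intro conjI allI impI)
  show "cfunctional (root_b (homothety l v) x)" for x
    using valid_cfunctional[OF v] by (simp add: homothety_def)
next
  fix c x assume "(\<Sum>x\<in>UNIV. c x *\<^sub>C coroot_a (homothety l v) x) = 0"
  then have "(\<Sum>x\<in>UNIV. (c x * l x) *\<^sub>C coroot_a v x) = 0"
    by (simp add: homothety_def scaleC_scaleC)
  then have "c x * l x = 0" by (rule coroot_a_independent[OF v])
  then show "c x = 0" using l by simp
next
  fix c x assume "\<forall>h. (\<Sum>x\<in>UNIV. c x * root_b (homothety l v) x h) = 0"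
  then have "\<And>h. (\<Sum>x\<in>UNIV. c x * root_b v x h) = 0" by (simp add: homothety_def)
  then show "c x = 0" by (rule root_b_independent[OF v])
qed

lemma arrow_valid: "arrow v \<theta> v' \<Longrightarrow> valid_root_datum v \<and> valid_root_datum v'"
  by (induction rule: arrow.induct) (auto simp: valid_reflexion valid_tautological valid_homothety)

lemma skeleton_refl: "v \<in> skeleton v"
  by (simp add: skeleton_def)

lemma skeleton_step: "u \<in> skeleton v \<Longrightarrow> reflectable u x \<Longrightarrow> reflexion x u \<in> skeleton v"
  unfolding skeleton_def by (auto intro: rtranclp.rtrancl_into_rtrancl)

lemma skeleton_induct [consumes 1, case_names base step]:
  assumes "u \<in> skeleton v" "Q v"
    and "\<And>u x. u \<in> skeleton v \<Longrightarrow> Q u \<Longrightarrow> reflectable u x \<Longrightarrow> Q (reflexion x u)"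
  shows "Q u"
  using assms(1) unfolding skeleton_def mem_Collect_eq
proof (induction rule: rtranclp_induct)
  case (step u u')
  then show ?case using assms(3)[of u] unfolding skeleton_def by auto
qed fact

lemma spine_induct [consumes 1, case_names base step]:
  assumes "u \<in> spine v" "Q v"
    and "\<And>u x. u \<in> spine v \<Longrightarrow> Q u \<Longrightarrow> reflectable u x \<Longrightarrow> cartan u x x = 0 \<Longrightarrow> Q (reflexion x u)"
  shows "Q u"
  using assms(1) unfolding spine_def mem_Collect_eq
proof (induction rule: rtranclp_induct)
  case (step u u')
  then show ?case using assms(3)[of u] unfolding spine_def by auto
qed fact

lemma spine_step: "u \<in> spine v \<Longrightarrow> reflectable u x \<Longrightarrow> cartan u x x = 0 \<Longrightarrow> reflexion x u \<in> spine v"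
  unfolding spine_def by (auto intro: rtranclp.rtrancl_into_rtrancl)

lemma spine_refl: "v \<in> spine v"
  by (simp add: spine_def)

lemma spine_subset: "u \<in> spine v \<Longrightarrow> u \<in> skeleton v"
  by (induction rule: spine_induct) (auto intro: skeleton_refl skeleton_step)

lemma skeleton_trans: "u' \<in> skeleton u \<Longrightarrow> u \<in> skeleton v \<Longrightarrow> u' \<in> skeleton v"
  unfolding skeleton_def by simp

lemma skeleton_valid: "u \<in> skeleton v \<Longrightarrow> valid_root_datum v \<Longrightarrow> valid_root_datum u"
  by (induction rule: skeleton_induct) (auto intro: valid_reflexion)

lemma skeleton_sym: "u \<in> skeleton v \<Longrightarrow> valid_root_datum v \<Longrightarrow> v \<in> skeleton u"
proof (induction rule: skeleton_induct)
  case base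
  then show ?case by (simp add: skeleton_refl)
next
  case (step u x)
  have "valid_root_datum u" using step skeleton_valid by blast
  then have "u \<in> skeleton (reflexion x u)"
    using skeleton_step[OF skeleton_refl reflectable_reflexion] step reflexion_reflexion by metis
  then show ?case using step skeleton_trans by blast
qed

lemma skeleton_arrow: "u \<in> skeleton v \<Longrightarrow> valid_root_datum v \<Longrightarrow> arrow v id u"
proof (induction rule: skeleton_induct)
  case base
  then show ?case by (rule arrow.arrow_id)
next
  case (step u x)
  then have "arrow u id (reflexion x u)"
    using skeleton_valid by (blast intro: arrow.arrow_reflexion)
  from arrow.arrow_compose[OF step.IH[OF step.prems] this] show ?case by simp
qed

lemma skeleton_tautological:
  assumes "u \<in> skeleton v" "bij \<theta>" "clinear \<theta>"
  shows "tautological \<theta> u \<in> skeleton (tautological \<theta> v)"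
  using assms(1)
proof (induction rule: skeleton_induct)
  case base
  then show ?case by (rule skeleton_refl)
next
  case (step u x)
  then show ?case
    using skeleton_step[OF step.IH, of x] assms by (simp add: reflectable_tautological reflexion_tautological)
qed

lemma root_sum_shift:
  fixes l :: "'x::finite \<Rightarrow> complex"
  assumes "\<And>y h. root_b v' y h = root_b v y h + l y * root_b v x h"
  shows "root_sum v' n h = root_sum v n h + (\<Sum>z\<in>UNIV. of_int (n z) * l z) * root_b v x h"
  by (simp add: root_sum_def assms distrib_left sum.distrib sum_distrib_right mult.assoc)

text \<open>The scalar \<open>c\<close> is an arbitrary complex number here. The equation at
  \<open>x\<close> shows that it is a difference of integers, and off \<open>x\<close> the
  coefficients agree.\<close>

lemma coeff_shift:
  assumes v: "valid_root_datum v" and eq: "\<And>h. root_sum v m h = root_sum v n h + c * root_b v x h"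
  shows "of_int (m y) = of_int (n y) + (if y = x then c else 0)"
proof -
  let ?d = "\<lambda>y. of_int (m y) - of_int (n y) - (if y = x then c else 0)"
  have "(\<Sum>y\<in>UNIV. ?d y * root_b v y h) = 0" for h
  proof -
    have "(\<Sum>y\<in>UNIV. (if y = x then c else 0) * root_b v y h) = c * root_b v x h"
      by (simp add: if_distrib[where f = "\<lambda>c. c * root_b v _ h"] cong: if_cong)
    then show ?thesis
      using eq[of h] by (simp add: root_sum_def left_diff_distrib sum_subtractf)
  qed
  from root_b_independent[OF v this, of y] show ?thesis by (simp add: algebra_simps)
qed

lemma root_sum_support_single:
  assumes "\<And>y. y \<noteq> x \<Longrightarrow> n y = 0"
  shows "root_sum v n h = of_int (n x) * root_b v x h"
proof -
  have "n = (\<lambda>y. if y = x then n x else 0)" using assms by auto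
  then show ?thesis using root_sum_single by metis
qed

lemma root_sum_basis: "root_sum v (\<lambda>y. if y = x then 1 else 0) = root_b v x"
  by (rule ext) (simp add: root_sum_single)

lemma root_sum_scale: "root_sum v (\<lambda>y. k * n y) h = of_int k * root_sum v n h"
  by (simp add: root_sum_def sum_distrib_left mult.assoc)

lemma group_GL: "group (GL :: ('h::complex_vector \<Rightarrow> 'h) monoid)"
proof (rule groupI)
  fix g h k :: "'h \<Rightarrow> 'h"
  show "\<one>\<^bsub>GL\<^esub> \<in> carrier (GL :: ('h \<Rightarrow> 'h) monoid)"
    by (auto simp: GL_def intro!: clinearI)
  show "\<one>\<^bsub>GL\<^esub> \<otimes>\<^bsub>GL\<^esub> g = g" by (simp add: GL_def)
  show "g \<otimes>\<^bsub>GL\<^esub> h \<otimes>\<^bsub>GL\<^esub> k = g \<otimes>\<^bsub>GL\<^esub> (h \<otimes>\<^bsub>GL\<^esub> k)" by (simp add: GL_def comp_assoc)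
  assume g: "g \<in> carrier GL"
  show "\<exists>h\<in>carrier GL. h \<otimes>\<^bsub>GL\<^esub> g = \<one>\<^bsub>GL\<^esub>"
    using g by (intro bexI[of _ "inv_into UNIV g"])
      (auto simp: GL_def clinear_inv bij_imp_bij_inv bij_is_inj)
  assume "h \<in> carrier GL"
  then show "g \<otimes>\<^bsub>GL\<^esub> h \<in> carrier GL"
    using g by (auto simp: GL_def bij_comp clinear_simps intro!: clinearI)
qed

lemma GL_simps:
  "g \<in> carrier GL \<longleftrightarrow> clinear g \<and> bij g" "g \<otimes>\<^bsub>GL\<^esub> h = g \<circ> h" "\<one>\<^bsub>GL\<^esub> = id"
  by (simp_all add: GL_def)

section \<open>The action of the Weyl group on the skeleton\<close>

locale coherent_skeleton =
  fixes v :: "('x::finite, 'h::fin_dim_complex_vector) root_datum"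
  assumes valid: "valid_root_datum v"
    and coherent: "u \<in> skeleton v \<Longrightarrow> u' \<in> skeleton v \<Longrightarrow>
      \<exists>n. root_b u x = root_sum u' n \<and> ((\<forall>y. 0 \<le> n y) \<or> (\<forall>y. n y \<le> 0))"
    and proportional: "u \<in> skeleton v \<Longrightarrow> u' \<in> skeleton v \<Longrightarrow> root_b u x = root_b u' y \<Longrightarrow>
      \<exists>c. coroot_a u x = c *\<^sub>C coroot_a u' y"
begin

abbreviation "rfl \<equiv> root_reflection v"
abbreviation "AR \<equiv> anisotropic_roots v"
abbreviation "PR \<equiv> principal_roots v"
abbreviation "cor \<equiv> coroot v"

lemma valid_u: "u \<in> skeleton v \<Longrightarrow> valid_root_datum u"
  using skeleton_valid valid by blast

lemma anisotropic_rootI: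
  "u \<in> skeleton v \<Longrightarrow> reflectable u x \<Longrightarrow> cartan u x x \<noteq> 0 \<Longrightarrow> root_b u x \<in> AR"
  unfolding anisotropic_roots_def real_roots_def by blast

lemma anisotropic_rootE:
  assumes "\<alpha> \<in> AR"
  obtains u x where "u \<in> skeleton v" "reflectable u x" "cartan u x x \<noteq> 0" "\<alpha> = root_b u x"
  using assms unfolding anisotropic_roots_def by blast

text \<open>The proportionality factor scales the coroot and its diagonal Cartan entry alike and
  cancels in the quotient. In particular, whether the diagonal entry vanishes depends on the root
  alone.\<close>

lemma normalized_coroot_eq:
  assumes u: "u \<in> skeleton v" "cartan u x x \<noteq> 0" and u': "u' \<in> skeleton v"
    and eq: "root_b u x = root_b u' y"
  shows "cartan u' y y \<noteq> 0" "(2 / cartan u' y y) *\<^sub>C coroot_a u' y = (2 / cartan u x x) *\<^sub>C coroot_a u x"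
proof -
  obtain c where c: "coroot_a u x = c *\<^sub>C coroot_a u' y"
    using proportional[OF u(1) u' eq] by blast
  have *: "cartan u x x = c * cartan u' y y"
    unfolding cartan_def c eq by (simp add: root_b_simps[OF valid_u[OF u']])
  then have "c \<noteq> 0" and 1: "cartan u' y y \<noteq> 0" using u(2) by auto
  then show "cartan u' y y \<noteq> 0" "(2 / cartan u' y y) *\<^sub>C coroot_a u' y = (2 / cartan u x x) *\<^sub>C coroot_a u x"
    unfolding * c by (simp_all add: scaleC_scaleC)
qed

text \<open>Independence of the chosen object and index makes the description operator in
  \<open>coroot\<close> well defined.\<close>

lemma coroot_eq:
  assumes "u \<in> skeleton v" "reflectable u x" "cartan u x x \<noteq> 0"
  shows "cor (root_b u x) = (2 / cartan u x x) *\<^sub>C coroot_a u x"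
  unfolding coroot_def
  using assms normalized_coroot_eq(2)[OF assms(1,3)] by (intro the_equality) blast+

lemma root_cfunctional: "\<alpha> \<in> AR \<Longrightarrow> cfunctional \<alpha>"
  by (elim anisotropic_rootE) (auto intro: valid_cfunctional valid_u)

lemmas root_simps = cfunctional_simps[OF root_cfunctional]

lemma root_coroot: "\<alpha> \<in> AR \<Longrightarrow> \<alpha> (cor \<alpha>) = 2"
proof (elim anisotropic_rootE)
  fix u x assume u: "u \<in> skeleton v" "reflectable u x" "cartan u x x \<noteq> 0" "\<alpha> = root_b u x"
  then show ?thesis
    using coroot_eq[OF u(1-3)] by (simp add: root_b_simps[OF valid_u[OF u(1)]] cartan_def)
qed

lemma refl_eq: "rfl \<alpha> h = h - \<alpha> h *\<^sub>C cor \<alpha>"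
  by (simp add: root_reflection_def)

lemma refl_refl: "\<alpha> \<in> AR \<Longrightarrow> rfl \<alpha> (rfl \<alpha> h) = h"
  by (simp add: refl_eq root_simps root_coroot flip: scaleC_add_left)

lemma refl_comp_refl: "\<alpha> \<in> AR \<Longrightarrow> rfl \<alpha> \<circ> rfl \<alpha> = id"
  by (simp add: fun_eq_iff refl_refl)

lemma refl_clinear: "\<alpha> \<in> AR \<Longrightarrow> clinear (rfl \<alpha>)"
  by (rule clinearI) (simp_all add: refl_eq root_simps scaleC_add_left scaleC_add_right scaleC_scaleC
      cvec.scale_right_diff_distrib)

lemma refl_bij: "\<alpha> \<in> AR \<Longrightarrow> bij (rfl \<alpha>)"
  by (rule o_bij[OF refl_comp_refl refl_comp_refl])

lemma inv_refl: "\<alpha> \<in> AR \<Longrightarrow> inv_into UNIV (rfl \<alpha>) = rfl \<alpha>"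
  by (rule inv_equality) (simp_all add: refl_refl)

lemma root_refl: "\<alpha> \<in> AR \<Longrightarrow> \<alpha> (rfl \<alpha> h) = - \<alpha> h"
  by (simp add: refl_eq root_simps root_coroot)

text \<open>The formula for the coroots is the reflection itself and the formula for the roots is
  composition with it; the inverse in \<open>tautological\<close> disappears because a reflection is
  an involution.\<close>

lemma anisotropic_reflexion_eq:
  assumes u: "u \<in> skeleton v" "reflectable u x" "cartan u x x \<noteq> 0"
  shows "reflexion x u = tautological (rfl (root_b u x)) u"
proof (rule root_datum.equality)
  note c = coroot_eq[OF u]
  note b = root_b_simps[OF valid_u[OF u(1)]]
  have "rfl (root_b u x) (coroot_a u y) = coroot_a (reflexion x u) y" for y
    using u(3) by (simp add: reflexion_def anisotropic_reflexion_def refl_eq c scaleC_scaleC mult.commute flip: cartan_def)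
  then show "coroot_a (reflexion x u) = coroot_a (tautological (rfl (root_b u x)) u)"
    by (simp add: fun_eq_iff)
  have "root_b u y (rfl (root_b u x) h) = root_b (reflexion x u) y h" for y h
    using u(3) by (simp add: reflexion_def anisotropic_reflexion_def refl_eq c b mult.commute flip: cartan_def)
  then show "root_b (reflexion x u) = root_b (tautological (rfl (root_b u x)) u)"
    by (simp add: fun_eq_iff inv_refl[OF anisotropic_rootI[OF u]])
qed (use u(3) in \<open>auto simp: reflexion_def anisotropic_reflexion_def\<close>)

definition W :: "('h \<Rightarrow> 'h) set" where "W = generate GL (rfl ` AR)"

lemma refl_GL: "rfl ` AR \<subseteq> carrier GL"
  by (auto simp: GL_simps refl_clinear refl_bij)

lemma W_subgroup: "subgroup W GL"
  unfolding W_def by (rule group.generate_is_subgroup[OF group_GL refl_GL])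

lemma W_linear: "g \<in> W \<Longrightarrow> clinear g" and W_bij: "g \<in> W \<Longrightarrow> bij g"
  using subgroup.subset[OF W_subgroup] by (auto simp: GL_simps subset_iff)

lemma refl_W: "\<alpha> \<in> AR \<Longrightarrow> rfl \<alpha> \<in> W"
  unfolding W_def by (auto intro: generate.incl)

lemma W_compose: "g \<in> W \<Longrightarrow> h \<in> W \<Longrightarrow> g \<circ> h \<in> W"
  using subgroup.m_closed[OF W_subgroup] by (simp add: GL_simps)

lemma GL_inv:
  assumes "clinear g" "bij g"
  shows "inv\<^bsub>GL\<^esub> g = inv_into UNIV g"
proof (rule group.inv_equality[OF group_GL])
  show "inv_into UNIV g \<otimes>\<^bsub>GL\<^esub> g = \<one>\<^bsub>GL\<^esub>"
    using assms(2) by (simp add: GL_simps bij_is_inj)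
qed (use assms in \<open>auto simp: GL_simps clinear_inv bij_imp_bij_inv\<close>)

lemma W_inv: "g \<in> W \<Longrightarrow> inv_into UNIV g \<in> W"
  using subgroup.m_inv_closed[OF W_subgroup] by (metis GL_inv W_linear W_bij)

lemma W_skeleton: "g \<in> W \<Longrightarrow> u \<in> skeleton v \<Longrightarrow> tautological g u \<in> skeleton v"
proof -
  have rfl: "tautological (rfl \<alpha>) u \<in> skeleton v" if "\<alpha> \<in> AR" "u \<in> skeleton v" for \<alpha> u
    using that(1)
  proof (rule anisotropic_rootE)
    fix w x assume w: "w \<in> skeleton v" "reflectable w x" "cartan w x x \<noteq> 0" "\<alpha> = root_b w x"
    \<comment> \<open>The base point moves to \<open>w\<close>, where the reflection is a single
      reflexion. Transporting the chain from \<open>w\<close> to \<open>u\<close> gives a chain that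
      starts at \<open>reflexion x w\<close>.\<close>
    have "u \<in> skeleton w" by (rule skeleton_trans[OF that(2) skeleton_sym[OF w(1) valid]])
    then have "tautological (rfl \<alpha>) u \<in> skeleton (reflexion x w)"
      unfolding anisotropic_reflexion_eq[OF w(1-3)] w(4)[symmetric]
      by (rule skeleton_tautological[OF _ refl_bij[OF that(1)] refl_clinear[OF that(1)]])
    then show ?thesis by (rule skeleton_trans[OF _ skeleton_step[OF w(1,2)]])
  qed
  assume "g \<in> W" "u \<in> skeleton v"
  then show ?thesis
    unfolding W_def
  proof (induction arbitrary: u rule: generate.induct)
    case one
    then show ?case unfolding GL_simps(3) tautological_id .
  next
    case (incl h)
    then show ?case using rfl by auto
  next
    case (inv h)
    then obtain \<alpha> where "\<alpha> \<in> AR" "h = rfl \<alpha>" by blast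
    then show ?case using rfl inv by (simp add: GL_inv refl_clinear refl_bij inv_refl)
  next
    case (eng g h)
    then have "tautological g (tautological h u) \<in> skeleton v" by blast
    moreover have "bij g" "bij h" using eng.hyps W_bij unfolding W_def by blast+
    ultimately show ?case unfolding GL_simps(2) by (simp only: tautological_compose)
  qed
qed

text \<open>Transporting by the inverse of \<open>g\<close> stays in the skeleton and replaces the
  root by \<open>\<alpha> \<circ> g\<close>, so the group acts on roots from the right. The coroot
  identity then yields the conjugation rule for reflections.\<close>

lemma W_root:
  assumes g: "g \<in> W" and \<alpha>: "\<alpha> \<in> AR"
  shows "\<alpha> \<circ> g \<in> AR" "g (cor (\<alpha> \<circ> g)) = cor \<alpha>" "g \<circ> rfl (\<alpha> \<circ> g) = rfl \<alpha> \<circ> g"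
proof -
  obtain u x where u: "u \<in> skeleton v" "reflectable u x" "cartan u x x \<noteq> 0" "\<alpha> = root_b u x"
    using \<alpha> by (rule anisotropic_rootE)
  let ?u = "tautological (inv_into UNIV g) u"
  have bij: "bij (inv_into UNIV g)" using g W_bij bij_imp_bij_inv by blast
  have b: "root_b ?u x = \<alpha> \<circ> g" using u(4) W_bij[OF g] by (simp add: inv_inv_eq)
  have sk: "?u \<in> skeleton v" using W_skeleton[OF W_inv[OF g] u(1)] .
  have r: "reflectable ?u x" "cartan ?u x x \<noteq> 0"
    using u bij by (simp_all add: reflectable_tautological cartan_tautological)
  show AR: "\<alpha> \<circ> g \<in> AR" using anisotropic_rootI[OF sk r] b by simp
  have "cor (\<alpha> \<circ> g) = (2 / cartan u x x) *\<^sub>C inv_into UNIV g (coroot_a u x)"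
    using coroot_eq[OF sk r] b bij by (simp add: cartan_tautological)
  then show c: "g (cor (\<alpha> \<circ> g)) = cor \<alpha>"
    using coroot_eq[OF u(1-3)] u(4) W_bij[OF g]
    by (simp add: clinear_simps[OF W_linear[OF g]] surj_f_inv_f bij_is_surj)
  show "g \<circ> rfl (\<alpha> \<circ> g) = rfl \<alpha> \<circ> g"
    by (simp add: fun_eq_iff refl_eq clinear_simps[OF W_linear[OF g]] c)
qed

section \<open>Positive roots along the spine\<close>

definition pos :: "('x, 'h) root_datum \<Rightarrow> ('h \<Rightarrow> complex) \<Rightarrow> bool"
  where "pos u \<alpha> \<longleftrightarrow> (\<exists>n. \<alpha> = root_sum u n \<and> (\<forall>y. 0 \<le> n y))"

lemma root_coherent:
  assumes "\<alpha> \<in> AR" "u \<in> skeleton v"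
  obtains n where "\<alpha> = root_sum u n" "(\<forall>y. 0 \<le> n y) \<or> (\<forall>y. n y \<le> 0)"
  using assms(1)
proof (rule anisotropic_rootE)
  fix w x assume "w \<in> skeleton v" "\<alpha> = root_b w x"
  then show thesis using coherent[of w u x] assms(2) that by blast
qed

lemma pos_coeff:
  assumes "pos u \<alpha>" "u \<in> skeleton v" "\<alpha> = root_sum u n"
  shows "0 \<le> n y"
  using assms root_sum_eq_iff[OF valid_u[OF assms(2)]] unfolding pos_def by metis

lemma not_pos_uminus:
  assumes "\<alpha> \<in> AR" "u \<in> skeleton v" "pos u \<alpha>"
  shows "\<not> pos u (\<lambda>h. - \<alpha> h)"
proof
  assume "pos u (\<lambda>h. - \<alpha> h)"
  then obtain m where m: "(\<lambda>h. - \<alpha> h) = root_sum u m" "\<And>y. 0 \<le> m y" unfolding pos_def by blast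
  have "\<alpha> = root_sum u (\<lambda>y. - 1 * m y)"
    using m(1) unfolding fun_eq_iff root_sum_scale by (metis minus_minus mult_minus1 of_int_1 of_int_minus)
  from pos_coeff[OF assms(3,2) this] have "m y = 0" for y using m(2)[of y] by (simp add: antisym)
  then have "\<alpha> h = 0" for h
    using fun_cong[OF m(1), of h] by (simp add: root_sum_def)
  then show False using root_coroot[OF assms(1)] by simp
qed

text \<open>Expanding \<open>root_b u x\<close> at \<open>u'\<close> and comparing coefficients at
  \<open>z\<close> gives a product of integers equal to 1.\<close>

lemma root_multiple:
  assumes "u \<in> skeleton v" "u' \<in> skeleton v" "\<And>h. root_b u' z h = of_int k * root_b u x h" "0 \<le> k"
  shows "k = 1"
proof -
  obtain m where m: "root_b u x = root_sum u' m"
    using coherent[OF assms(1,2)] by blast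
  have "root_sum u' (\<lambda>y. if y = z then 1 else 0) = root_sum u' (\<lambda>y. k * m y)"
    using assms(3) by (simp add: fun_eq_iff root_sum_scale root_sum_basis m)
  then have "(\<lambda>y. if y = z then 1 else 0) = (\<lambda>y. k * m y)"
    using root_sum_eq_iff[OF valid_u[OF assms(2)]] by blast
  from fun_cong[OF this, of z] have "k * m z = 1" by simp
  then show ?thesis using assms(4) zmult_eq_1_iff by auto
qed

lemma root_support_single:
  assumes "\<alpha> \<in> AR" "u \<in> skeleton v" "\<alpha> = root_sum u n" "\<And>y. y \<noteq> x \<Longrightarrow> n y = 0" "0 \<le> n x"
  shows "\<alpha> = root_b u x"
proof -
  obtain u' z where u': "u' \<in> skeleton v" "\<alpha> = root_b u' z"
    using assms(1) by (rule anisotropic_rootE)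
  have *: "\<alpha> h = of_int (n x) * root_b u x h" for h
    using assms(3,4) root_sum_support_single by metis
  then have "n x = 1" using root_multiple[OF assms(2) u'(1)] u'(2) assms(5) by blast
  then show ?thesis using * by (simp add: fun_eq_iff)
qed

text \<open>Only the coefficient at \<open>x\<close> can change. A positive coefficient elsewhere
  fixes the sign by coherence; without one, the root would be \<open>root_b u x\<close>, whose
  diagonal Cartan entry is zero, contrary to anisotropy.\<close>

lemma pos_isotropic_reflexion:
  assumes u: "u \<in> skeleton v" "reflectable u x" "cartan u x x = 0" and \<alpha>: "\<alpha> \<in> AR" "pos u \<alpha>"
  shows "pos (reflexion x u) \<alpha>"
proof -
  let ?u = "reflexion x u"
  have sk: "?u \<in> skeleton v" by (rule skeleton_step[OF u(1,2)])
  obtain l where l: "\<And>y h. root_b ?u y h = root_b u y h + l y * root_b u x h"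
    by (rule reflexion_shift[of x u]) (rule that)
  obtain n where n: "\<alpha> = root_sum u n" "\<And>y. 0 \<le> n y" using \<alpha>(2) unfolding pos_def by blast
  obtain m where m: "\<alpha> = root_sum ?u m" "(\<forall>y. 0 \<le> m y) \<or> (\<forall>y. m y \<le> 0)"
    using root_coherent[OF \<alpha>(1) sk] by blast
  let ?c = "\<Sum>z\<in>UNIV. of_int (m z) * l z"
  have "root_sum u n h = root_sum u m h + ?c * root_b u x h" for h
    using root_sum_shift[where v' = ?u and l = l, OF l, of m h] n(1) m(1) by metis
  from coeff_shift[OF valid_u[OF u(1)] this]
  have shift: "complex_of_int (n y) = of_int (m y) + (if y = x then ?c else 0)" for y .
  have eq: "n y = m y" if "y \<noteq> x" for y using shift[of y] that by simp
  show ?thesis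
  proof (cases "\<exists>y. y \<noteq> x \<and> 0 < n y")
    case True
    then have "\<forall>y. 0 \<le> m y" using m(2) eq by (metis not_less)
    then show ?thesis using m(1) unfolding pos_def by blast
  next
    case False
    then have "\<alpha> = root_b u x"
      using root_support_single[OF \<alpha>(1) u(1) n(1)] n(2) by (metis antisym_conv1)
    moreover obtain w y where w: "w \<in> skeleton v" "cartan w y y \<noteq> 0" "\<alpha> = root_b w y"
      using \<alpha>(1) by (rule anisotropic_rootE)
    ultimately have "cartan u x x \<noteq> 0" using normalized_coroot_eq(1)[OF w(1,2) u(1)] by metis
    then show ?thesis using u(3) by blast
  qed
qed

lemma pos_spine: "u \<in> spine v \<Longrightarrow> \<alpha> \<in> AR \<Longrightarrow> pos u \<alpha> \<longleftrightarrow> pos v \<alpha>"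
proof (induction rule: spine_induct)
  case (step u x)
  have u: "u \<in> skeleton v" by (rule spine_subset[OF step.hyps(1)])
  let ?u = "reflexion x u"
  note V = valid_u[OF u]
  \<comment> \<open>The reflexion at \<open>x\<close> leads back to \<open>u\<close>, so the
    one-sided lemma also gives the converse.\<close>
  have u': "?u \<in> skeleton v" "reflectable ?u x" "cartan ?u x x = 0" "reflexion x ?u = u"
    using step.hyps skeleton_step[OF u step.hyps(2)] reflectable_reflexion[OF V step.hyps(2)]
      cartan_isotropic_reflexion(1)[OF V step.hyps(3), of x] reflexion_reflexion[OF V] by simp_all
  have "pos ?u \<alpha> \<longleftrightarrow> pos u \<alpha>"
    using pos_isotropic_reflexion[OF u step.hyps(2,3) step.prems] pos_isotropic_reflexion[OF u'(1-3) step.prems] u'(4)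
    by auto
  then show ?case using step by blast
qed simp

lemma principal_rootE:
  assumes "\<alpha> \<in> PR"
  obtains u x where "\<alpha> \<in> AR" "u \<in> spine v" "u \<in> skeleton v" "\<alpha> = root_b u x"
  using assms spine_subset unfolding principal_roots_def by blast

lemma principal_AR: "\<alpha> \<in> PR \<Longrightarrow> \<alpha> \<in> AR"
  unfolding principal_roots_def by blast

lemma pos_root_b: "pos u (root_b u x)"
  unfolding pos_def by (intro exI[of _ "\<lambda>y. if y = x then 1 else 0"]) (simp add: root_sum_basis)

lemma principal_pos: "\<alpha> \<in> PR \<Longrightarrow> pos v \<alpha>"
  by (elim principal_rootE) (metis pos_root_b pos_spine)

lemma root_comp_refl: "\<beta> \<in> AR \<Longrightarrow> \<beta> (rfl \<alpha> h) = \<beta> h - \<alpha> h * \<beta> (cor \<alpha>)"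
  by (simp add: refl_eq root_simps)

text \<open>At a spine object where \<open>\<beta>\<close> is simple, its reflection changes one
  coefficient only. If the sign flips, all other coefficients of \<open>\<gamma>\<close>
  vanish.\<close>

lemma principal_flip:
  assumes \<gamma>: "\<gamma> \<in> AR" "pos v \<gamma>" and \<beta>: "\<beta> \<in> PR" and np: "\<not> pos v (\<gamma> \<circ> rfl \<beta>)"
  shows "\<gamma> = \<beta>"
proof -
  obtain u x where u: "\<beta> \<in> AR" "u \<in> spine v" "u \<in> skeleton v" "\<beta> = root_b u x"
    using \<beta> by (rule principal_rootE)
  have r: "\<gamma> \<circ> rfl \<beta> \<in> AR" using W_root(1)[OF refl_W[OF u(1)] \<gamma>(1)] .
  obtain n where n: "\<gamma> = root_sum u n" "\<And>y. 0 \<le> n y"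
    using \<gamma> pos_spine[OF u(2)] unfolding pos_def by blast
  obtain m where m: "\<gamma> \<circ> rfl \<beta> = root_sum u m" "(\<forall>y. 0 \<le> m y) \<or> (\<forall>y. m y \<le> 0)"
    using root_coherent[OF r u(3)] by blast
  have neg: "m y \<le> 0" for y
    using np m pos_spine[OF u(2) r] unfolding pos_def by metis
  have "root_sum u m h = root_sum u n h + (- \<gamma> (cor \<beta>)) * root_b u x h" for h
    using fun_cong[OF m(1), of h] root_comp_refl[OF \<gamma>(1), of \<beta> h] n(1) u(4) by (simp add: mult.commute)
  from coeff_shift[OF valid_u[OF u(3)] this]
  have shift: "complex_of_int (m y) = of_int (n y) + (if y = x then - \<gamma> (cor \<beta>) else 0)" for y .
  have "m y = n y" if "y \<noteq> x" for y using shift[of y] that by simp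
  then have "n y = 0" if "y \<noteq> x" for y using that neg[of y] n(2)[of y] by simp
  then show ?thesis using root_support_single[OF \<gamma>(1) u(3) n(1)] n(2) u(4) by metis
qed

section \<open>Generation by principal reflections and the Coxeter system\<close>

lemma generate_PR_subset: "generate GL (rfl ` PR) \<subseteq> W"
  unfolding W_def by (rule group.mono_generate[OF group_GL]) (use principal_AR in blast)

text \<open>Reflexions commute with tautological arrows, so each step can be made at the spine
  object \<open>w\<close>. An isotropic step moves \<open>w\<close>; an anisotropic one multiplies
  \<open>g\<close> on the right by a principal reflection.\<close>

lemma skeleton_decomposition:
  assumes "u \<in> skeleton v"
  shows "\<exists>g\<in>generate GL (rfl ` PR). \<exists>w\<in>spine v. u = tautological g w"
  using assms
proof (induction rule: skeleton_induct)
  case base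
  then show ?case
    using generate.one[of GL] spine_refl by (metis GL_simps(3) tautological_id)
next
  case (step u x)
  then obtain g w where g: "g \<in> generate GL (rfl ` PR)" and w: "w \<in> spine v" and u: "u = tautological g w" by blast
  have gW: "g \<in> W" using g generate_PR_subset by blast
  note gl = W_bij[OF gW] W_linear[OF gW]
  have r: "reflectable w x" "reflexion x u = tautological g (reflexion x w)"
    using step.hyps u gl by (simp_all add: reflectable_tautological reflexion_tautological)
  show ?case
  proof (cases "cartan w x x = 0")
    case True
    then show ?thesis using spine_step[OF w r(1)] g r(2) by blast
  next
    case False
    let ?\<beta> = "root_b w x"
    have \<beta>: "?\<beta> \<in> AR" using anisotropic_rootI[OF spine_subset[OF w] r(1) False] .
    then have PR: "?\<beta> \<in> PR" using w unfolding principal_roots_def by blast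
    have "reflexion x u = tautological (g \<circ> rfl ?\<beta>) w"
      using r anisotropic_reflexion_eq[OF spine_subset[OF w] r(1) False] gl refl_bij[OF \<beta>]
      by (simp add: tautological_compose)
    moreover have "g \<circ> rfl ?\<beta> \<in> generate GL (rfl ` PR)"
      using generate.eng[OF g generate.incl[of "rfl ?\<beta>"]] PR by (simp add: GL_simps)
    ultimately show ?thesis using w by blast
  qed
qed

text \<open>If \<alpha> occurs at \<open>tautological g w\<close> with \<open>w\<close> in the
  spine, then \<open>\<alpha> \<circ> g\<close> is principal, and the reflection of \<alpha> is
  conjugate to a principal one by \<open>g\<close>.\<close>

lemma generate_PR: "generate GL (rfl ` PR) = W"
proof
  have "rfl \<alpha> \<in> generate GL (rfl ` PR)" if \<alpha>: "\<alpha> \<in> AR" for \<alpha>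
  proof -
    let ?G = "generate GL (rfl ` PR)"
    have sub: "subgroup ?G GL"
      using refl_GL principal_AR by (intro group.generate_is_subgroup[OF group_GL]) blast
    obtain u x where u: "u \<in> skeleton v" "reflectable u x" "cartan u x x \<noteq> 0" "\<alpha> = root_b u x"
      using \<alpha> by (rule anisotropic_rootE)
    obtain g w where g: "g \<in> ?G" and w: "w \<in> spine v" "u = tautological g w"
      using skeleton_decomposition[OF u(1)] by blast
    have gW: "g \<in> W" using g generate_PR_subset by blast
    let ?\<beta> = "root_b w x"
    have \<beta>: "?\<beta> = \<alpha> \<circ> g" using u(4) w(2) W_bij[OF gW] by (simp add: fun_eq_iff bij_is_inj)
    have "?\<beta> \<in> PR" using W_root(1)[OF gW \<alpha>] w(1) unfolding \<beta>[symmetric] principal_roots_def by blast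
    then have "rfl ?\<beta> \<in> ?G" by (auto intro: generate.incl)
    then have "(g \<circ> rfl ?\<beta>) \<circ> inv_into UNIV g \<in> ?G"
      using subgroup.m_closed[OF sub] subgroup.m_inv_closed[OF sub g] g
      by (metis GL_inv GL_simps(2) W_bij W_linear gW)
    moreover have "(g \<circ> rfl ?\<beta>) \<circ> inv_into UNIV g = rfl \<alpha>"
      using W_root(3)[OF gW \<alpha>, folded \<beta>] W_bij[OF gW]
      by (simp add: fun_eq_iff surj_f_inv_f bij_is_surj)
    ultimately show ?thesis by simp
  qed
  then have "rfl ` AR \<subseteq> generate GL (rfl ` PR)" by blast
  moreover have "subgroup (generate GL (rfl ` PR)) GL"
    using refl_GL principal_AR by (intro group.generate_is_subgroup[OF group_GL]) blast
  ultimately show "W \<subseteq> generate GL (rfl ` PR)"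
    unfolding W_def by (rule group.generate_subgroup_incl[OF group_GL])
qed (rule generate_PR_subset)

lemma weyl_group_eq: "weyl_group v = GL\<lparr>carrier := W\<rparr>"
  by (simp add: weyl_group_def W_def)

lemma weyl_group_simps:
  "carrier (weyl_group v) = W" "g \<otimes>\<^bsub>weyl_group v\<^esub> h = g \<circ> h" "\<one>\<^bsub>weyl_group v\<^esub> = id"
  unfolding weyl_group_eq by (simp_all add: GL_def)

lemma group_weyl: "group (weyl_group v)"
  unfolding weyl_group_eq by (rule subgroup.subgroup_is_group[OF W_subgroup group_GL])

lemma refl_neq_id: "\<alpha> \<in> AR \<Longrightarrow> rfl \<alpha> \<noteq> id"
  using root_refl[of \<alpha> "cor \<alpha>"] root_coroot[of \<alpha>] by force

lemma coxeter_system_weyl: "coxeter_system (weyl_group v) (rfl ` PR)"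
proof -
  \<comment> \<open>Half-spaces are indexed by reflections, so a principal root is chosen for each
    of them.\<close>
  define P where "P s = {g. pos v ((SOME \<alpha>. \<alpha> \<in> PR \<and> rfl \<alpha> = s) \<circ> g)}" for s
  have P: "\<exists>\<alpha>\<in>PR. rfl \<alpha> = s \<and> P s = {g. pos v (\<alpha> \<circ> g)}" if "s \<in> rfl ` PR" for s
  proof -
    have "\<exists>\<alpha>. \<alpha> \<in> PR \<and> rfl \<alpha> = s" using that by blast
    from someI_ex[OF this] show ?thesis unfolding P_def by blast
  qed
  interpret half_spaces "weyl_group v" "rfl ` PR" P
  proof (intro half_spaces.intro[OF group_weyl] half_spaces_axioms.intro, unfold weyl_group_simps)
    show sub: "rfl ` PR \<subseteq> W" using refl_W principal_AR by blast
    show "generate (weyl_group v) (rfl ` PR) = W"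
      unfolding weyl_group_eq group.generate_consistent[OF group_GL sub W_subgroup] by (rule generate_PR)
  next
    fix s assume "s \<in> rfl ` PR"
    then show "s \<noteq> id" "s \<circ> s = id" using refl_neq_id refl_comp_refl principal_AR by auto
  next
    fix s assume "s \<in> rfl ` PR"
    then show "id \<in> P s" using P[of s] principal_pos by auto
  next
    fix s g assume s: "s \<in> rfl ` PR" and g: "g \<in> W" "g \<in> P s"
    obtain \<alpha> where \<alpha>: "\<alpha> \<in> PR" "rfl \<alpha> = s" "P s = {g. pos v (\<alpha> \<circ> g)}" using P[OF s] by blast
    have "\<alpha> \<circ> (rfl \<alpha> \<circ> g) = (\<lambda>h. - (\<alpha> \<circ> g) h)"
      using root_refl[OF principal_AR[OF \<alpha>(1)]] by (simp add: fun_eq_iff)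
    then show "s \<circ> g \<notin> P s"
      using not_pos_uminus[OF W_root(1)[OF g(1) principal_AR[OF \<alpha>(1)]] skeleton_refl] g(2) \<alpha> by simp
  next
    fix s t g assume s: "s \<in> rfl ` PR" and t: "t \<in> rfl ` PR" and g: "g \<in> W" "g \<in> P s" "g \<circ> t \<notin> P s"
    obtain \<alpha> where \<alpha>: "\<alpha> \<in> PR" "rfl \<alpha> = s" "P s = {g. pos v (\<alpha> \<circ> g)}" using P[OF s] by blast
    obtain \<beta> where \<beta>: "\<beta> \<in> PR" "t = rfl \<beta>" using t by blast
    \<comment> \<open>The root \<open>\<alpha> \<circ> g\<close> is positive and the reflection of
      \<beta> flips its sign, which happens to \<beta> alone.\<close>
    have "\<alpha> \<circ> g = \<beta>"
      using g \<alpha> \<beta> by (intro principal_flip W_root(1)[OF g(1) principal_AR]) (auto simp: comp_assoc)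
    then show "s \<circ> g = g \<circ> t"
      using W_root(3)[OF g(1) principal_AR[OF \<alpha>(1)]] \<alpha>(2) \<beta>(2) by simp
  qed
  show ?thesis by (rule coxeter_system)
qed

section \<open>Cartan integers of two principal roots\<close>

text \<open>If \<alpha> had no coefficient off \<open>y\<close>, it would equal \<beta>. The index
  \<open>z\<close> serves as witness both for independence and for the sign of the pairing.\<close>

lemma principal_support:
  assumes "\<alpha> \<in> PR" "\<beta> \<in> PR" "\<alpha> \<noteq> \<beta>"
  obtains u y k z where "u \<in> spine v" "u \<in> skeleton v" "\<beta> = root_b u y" "\<alpha> = root_sum u k" "z \<noteq> y" "0 < k z"
proof -
  obtain u y where u: "u \<in> spine v" "u \<in> skeleton v" "\<beta> = root_b u y"
    using assms(2) by (rule principal_rootE)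
  have \<alpha>: "\<alpha> \<in> AR" "pos u \<alpha>" using assms(1) principal_AR principal_pos pos_spine[OF u(1)] by blast+
  then obtain k where k: "\<alpha> = root_sum u k" "\<And>y. 0 \<le> k y" unfolding pos_def by blast
  have "\<exists>z. z \<noteq> y \<and> k z \<noteq> 0"
    using root_support_single[OF \<alpha>(1) u(2) k(1), of y] k(2) u(3) assms(3) by blast
  then obtain z where "z \<noteq> y" "k z \<noteq> 0" by blast
  then show thesis using that[OF u k(1), of z] k(2)[of z] by simp
qed

lemma principal_independent:
  assumes "\<alpha> \<in> PR" "\<beta> \<in> PR" "\<alpha> \<noteq> \<beta>" and eq: "\<And>h. of_int c * \<alpha> h = of_int d * \<beta> h"
  shows "c = 0"
proof -
  obtain u y k z where u: "u \<in> skeleton v" "\<beta> = root_b u y" "\<alpha> = root_sum u k" and z: "z \<noteq> y" "0 < k z"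
    using assms(1-3) by (rule principal_support)
  have "root_sum u (\<lambda>x. c * k x) h = root_sum u (\<lambda>x. 0) h + of_int d * root_b u y h" for h
    using eq[of h] u by (simp add: root_sum_scale)
  from coeff_shift[OF valid_u[OF u(1)] this, of z] show ?thesis using z by simp
qed

text \<open>Integrality is seen at an object where \<alpha> is simple, as the change of its
  coefficient under reflection. The sign is seen at one where \<beta> is simple: there the reflected
  root, which is \<beta> plus \<open>a\<close> times \<alpha>, is positive and has coefficient
  \<open>a * k z\<close> at \<open>z\<close>.\<close>

lemma principal_pairing:
  assumes "\<alpha> \<in> PR" "\<beta> \<in> PR" "\<alpha> \<noteq> \<beta>"
  obtains a :: int where "0 \<le> a" "\<beta> (cor \<alpha>) = - of_int a"
proof -
  note AR = principal_AR[OF assms(1)] principal_AR[OF assms(2)]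
  have r: "\<beta> \<circ> rfl \<alpha> \<in> AR" by (rule W_root(1)[OF refl_W[OF AR(1)] AR(2)])
  obtain w x where w: "w \<in> skeleton v" "\<alpha> = root_b w x" using assms(1) by (rule principal_rootE)
  obtain n where n: "\<beta> = root_sum w n" using root_coherent[OF AR(2) w(1)] by blast
  obtain m where m: "\<beta> \<circ> rfl \<alpha> = root_sum w m" using root_coherent[OF r w(1)] by blast
  have "root_sum w m h = root_sum w n h + (- \<beta> (cor \<alpha>)) * root_b w x h" for h
    using fun_cong[OF m, of h] root_comp_refl[OF AR(2), of \<alpha> h] n w(2) by (simp add: mult.commute)
  from coeff_shift[OF valid_u[OF w(1)] this, of x]
  have coeff: "complex_of_int (m x) = of_int (n x) + (if x = x then - \<beta> (cor \<alpha>) else 0)" .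
  define a where "a = m x - n x"
  from coeff have p: "\<beta> (cor \<alpha>) = - of_int a" by (simp add: a_def algebra_simps)
  obtain u y k z where u: "u \<in> spine v" "u \<in> skeleton v" "\<beta> = root_b u y" "\<alpha> = root_sum u k" and z: "z \<noteq> y" "0 < k z"
    using assms by (rule principal_support)
  have "pos v (\<beta> \<circ> rfl \<alpha>)"
    using principal_flip[OF AR(2) principal_pos[OF assms(2)] assms(1)] assms(3) by metis
  then obtain l where l: "\<beta> \<circ> rfl \<alpha> = root_sum u l" "0 \<le> l z"
    using pos_spine[OF u(1) r] unfolding pos_def by blast
  have "root_sum u l h = root_sum u (\<lambda>x. a * k x) h + 1 * root_b u y h" for h
    using fun_cong[OF l(1), of h] root_comp_refl[OF AR(2), of \<alpha> h] p
    unfolding root_sum_scale u(3,4)[symmetric] by (simp add: algebra_simps)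
  from coeff_shift[OF valid_u[OF u(2)] this, of z] have "complex_of_int (l z) = of_int (a * k z)"
    using z(1) by simp
  then have "l z = a * k z" by (simp only: of_int_eq_iff)
  then have "0 \<le> a" using l(2) z(2) by (simp add: zero_le_mult_iff)
  then show thesis using that p by blast
qed

text \<open>A reflection that fixes the root \<beta> also fixes its coroot, by equivariance of
  coroots.\<close>

lemma pairing_zero:
  assumes "\<alpha> \<in> AR" "\<beta> \<in> AR" "\<beta> (cor \<alpha>) = 0"
  shows "\<alpha> (cor \<beta>) = 0"
proof -
  have "\<beta> \<circ> rfl \<alpha> = \<beta>" using root_comp_refl[OF assms(2)] assms(3) by (simp add: fun_eq_iff)
  then have "rfl \<alpha> (cor \<beta>) = cor \<beta>" using W_root(2)[OF refl_W[OF assms(1)] assms(2)] by simp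
  then have "\<alpha> (cor \<beta>) *\<^sub>C cor \<alpha> = 0" by (simp add: refl_eq)
  moreover have "cor \<alpha> \<noteq> 0" using root_coroot[OF assms(1)] root_simps(5)[OF assms(1)] by force
  ultimately show ?thesis by simp
qed

lemma weyl_pow: "g [^]\<^bsub>weyl_group v\<^esub> (n::nat) = g ^^ n"
proof (induction n)
  case 0
  then show ?case using monoid.nat_pow_0[OF group.is_monoid[OF group_weyl]] by (simp add: weyl_group_simps)
next
  case (Suc n)
  then show ?case
    using monoid.nat_pow_Suc[OF group.is_monoid[OF group_weyl]]
    by (simp add: weyl_group_simps funpow_Suc_right del: funpow.simps)
qed

end

section \<open>Coxeter exponents\<close>

locale principal_pair = coherent_skeleton +
  fixes \<alpha> \<beta> and a b :: int
  assumes principal: "\<alpha> \<in> PR" "\<beta> \<in> PR" "\<alpha> \<noteq> \<beta>"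
    and a: "0 \<le> a" "\<beta> (cor \<alpha>) = - of_int a"
    and b: "0 \<le> b" "\<alpha> (cor \<beta>) = - of_int b"
begin

definition T :: "'b \<Rightarrow> 'b" where "T = rfl \<alpha> \<circ> rfl \<beta>"

lemmas AR = principal_AR[OF principal(1)] principal_AR[OF principal(2)]

lemma alpha_T: "\<alpha> (T h) = - \<alpha> h - of_int b * \<beta> h"
  by (simp add: T_def root_refl[OF AR(1)] root_comp_refl[OF AR(1), of \<beta>] b algebra_simps)

lemma beta_T: "\<beta> (T h) = of_int a * \<alpha> h + (of_int a * of_int b - 1) * \<beta> h"
  by (simp add: T_def root_refl[OF AR(2)] root_comp_refl[OF AR(1), of \<beta>] root_comp_refl[OF AR(2), of \<alpha>] a b algebra_simps)

lemma T_eq: "T h = h - \<beta> h *\<^sub>C cor \<beta> - (\<alpha> h + of_int b * \<beta> h) *\<^sub>C cor \<alpha>"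
proof -
  have "T h = rfl \<beta> h - \<alpha> (rfl \<beta> h) *\<^sub>C cor \<alpha>" by (simp add: T_def refl_eq)
  also have "\<alpha> (rfl \<beta> h) = \<alpha> h + of_int b * \<beta> h" by (simp add: root_comp_refl[OF AR(1)] b)
  finally show ?thesis by (simp add: refl_eq)
qed

text \<open>The displacement of \<open>h\<close> lies in the span of two coroots, with coefficients
  summed along the orbit. Finite order thus reduces to the vanishing of two scalar sums, whatever
  the dimension.\<close>

lemma T_pow: "(T ^^ n) h = h - (\<Sum>i<n. \<beta> ((T ^^ i) h)) *\<^sub>C cor \<beta>
    - (\<Sum>i<n. \<alpha> ((T ^^ i) h) + of_int b * \<beta> ((T ^^ i) h)) *\<^sub>C cor \<alpha>"
proof (induction n)
  case (Suc n)
  have "(T ^^ Suc n) h = T ((T ^^ n) h)" by simp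
  also have "\<dots> = (T ^^ n) h - \<beta> ((T ^^ n) h) *\<^sub>C cor \<beta> - (\<alpha> ((T ^^ n) h) + of_int b * \<beta> ((T ^^ n) h)) *\<^sub>C cor \<alpha>"
    by (rule T_eq)
  finally show ?case
    by (subst (asm) Suc.IH) (simp add: scaleC_add_left algebra_simps)
qed simp

lemma zero_iff: "a = 0 \<longleftrightarrow> b = 0"
  using pairing_zero[OF AR] pairing_zero[OF AR(2,1)] a b by auto

lemma T_finite_order:
  assumes "(a * b, m) \<in> {(0, 2), (1, 3), (2, 4), (3, 6)}"
  shows "T ^^ m = id"
proof
  fix h
  \<comment> \<open>With this rescaling the recursion depends on \<open>a * b\<close> only. Its
    matrix has determinant 1 and trace \<open>a * b - 2\<close>; for \<open>a * b = 1, 2, 3\<close>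
    the eigenvalues are primitive roots of unity of order 3, 4, 6, whose powers over a period sum to
    zero.\<close>
  define e where "e n = of_int a * \<alpha> ((T ^^ n) h)" for n
  define j where "j n = \<beta> ((T ^^ n) h)" for n
  have ab: "complex_of_int a * of_int b = of_int (a * b)" by simp
  have e: "e (Suc n) = - e n - of_int (a * b) * j n" for n
    by (simp add: e_def j_def alpha_T algebra_simps)
  have j: "j (Suc n) = e n + (of_int (a * b) - 1) * j n" for n
    by (simp add: e_def j_def beta_T algebra_simps)
  have sums: "(\<Sum>i<m. \<beta> ((T ^^ i) h)) = 0 \<and> (\<Sum>i<m. \<alpha> ((T ^^ i) h) + of_int b * \<beta> ((T ^^ i) h)) = 0"
  proof (cases "a = 0")
    \<comment> \<open>For \<open>a = 0\<close> the rescaled sequence loses \<alpha>. Then also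
      \<open>b = 0\<close>, and \<open>T\<close> negates both functionals.\<close>
    case True
    then show ?thesis using assms zero_iff by (simp add: eval_nat_numeral alpha_T beta_T)
  next
    case False
    then have "a * b \<noteq> 0" using zero_iff by simp
    then have "(a * b = 1 \<and> m = 3) \<or> (a * b = 2 \<and> m = 4) \<or> (a * b = 3 \<and> m = 6)" using assms by auto
    then have *: "(\<Sum>i<m. j i) = 0 \<and> (\<Sum>i<m. e i + of_int (a * b) * j i) = 0"
      by (elim disjE conjE) (simp_all only:, simp_all add: eval_nat_numeral e j)
    have "of_int a * (\<Sum>i<m. \<alpha> ((T ^^ i) h) + of_int b * \<beta> ((T ^^ i) h)) = (\<Sum>i<m. e i + of_int (a * b) * j i)"
      by (simp add: sum_distrib_left e_def j_def distrib_left mult.assoc)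
    then show ?thesis using * False by (simp add: j_def)
  qed
  show "(T ^^ m) h = id h"
    by (subst T_pow) (simp add: sums)
qed

text \<open>The inequality \<open>2 c \<le> a d\<close> is preserved because \<open>ab \<ge> 4\<close>, and it keeps the coefficients positive.\<close>

lemma T_coefficients:
  assumes ab: "4 \<le> a * b"
  shows "\<exists>c d :: int. (\<forall>h. \<beta> ((T ^^ n) h) = of_int c * \<alpha> h + of_int d * \<beta> h) \<and>
    0 < d \<and> 2 * c \<le> a * d \<and> 0 \<le> c \<and> (0 < n \<longrightarrow> 0 < c)"
proof (induction n)
  case 0
  show ?case using a by (intro exI[of _ 0] exI[of _ 1]) auto
next
  case (Suc n)
  then obtain c d :: int where cd: "\<And>h. \<beta> ((T ^^ n) h) = of_int c * \<alpha> h + of_int d * \<beta> h"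
    "0 < d" "2 * c \<le> a * d" "0 \<le> c" by blast
  \<comment> \<open>The new coefficients come from inserting \<open>T h\<close> for \<open>h\<close>
    in the formula for the \<open>n\<close>-th power.\<close>
  let ?c = "a * d - c" and ?d = "(a * b - 1) * d - b * c"
  have "0 < a" using a ab by (cases "a = 0") auto
  then have ad: "0 < a * d" using cd(2) by simp
  have "\<beta> ((T ^^ Suc n) h) = of_int ?c * \<alpha> h + of_int ?d * \<beta> h" for h
    unfolding funpow_Suc_right comp_apply cd(1) by (simp add: alpha_T beta_T algebra_simps)
  moreover have "0 < ?c" using cd(3) ad by simp
  moreover have "0 < ?d"
  proof -
    have "0 \<le> b * (a * d - 2 * c)" using b cd(3) by simp
    moreover have "0 < (a * b - 2) * d" using ab cd(2) by simp
    ultimately show ?thesis by (simp add: algebra_simps)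
  qed
  \<comment> \<open>The two nonnegative products below add up to twice the difference of the sides;
    likewise, the two products above add up to twice \<open>?d\<close>.\<close>
  moreover have "2 * ?c \<le> a * ?d"
  proof -
    have "0 \<le> (a * b - 2) * (a * d - 2 * c)" using ab cd(3) by simp
    moreover have "0 \<le> (a * b - 4) * (a * d)" using ab ad by simp
    ultimately show ?thesis by (simp add: algebra_simps)
  qed
  ultimately show ?case by (intro exI[of _ ?c] exI[of _ ?d]) auto
qed

text \<open>A trivial power would give a linear relation between \<alpha> and \<beta> with the
  positive coefficient \<open>c\<close>, against their independence.\<close>

lemma T_infinite_order:
  assumes "4 \<le> a * b" "0 < n"
  shows "T ^^ n \<noteq> id"
proof
  assume id: "T ^^ n = id"
  obtain c d :: int where cd: "\<And>h. \<beta> ((T ^^ n) h) = of_int c * \<alpha> h + of_int d * \<beta> h" "0 < c"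
    using T_coefficients[OF assms(1), of n] assms(2) by blast
  have "of_int c * \<alpha> h = of_int (1 - d) * \<beta> h" for h
    using cd(1)[of h] id by (simp add: algebra_simps)
  from principal_independent[OF principal this] cd(2) show False by simp
qed

text \<open>This excludes exponent 1. Triviality would force \<open>a = 0\<close> by independence,
  and then \<beta> would be negated and fixed at once.\<close>

lemma T_neq_id: "T \<noteq> id"
proof
  assume id: "T = id"
  have "of_int a * \<alpha> h = of_int (2 - a * b) * \<beta> h" for h
    using beta_T[of h] id by (simp add: algebra_simps)
  from principal_independent[OF principal this] have "a = 0" .
  then show False using beta_T[of "cor \<beta>"] id root_coroot[OF AR(2)] by simp
qed

lemma exponent: "coxeter_exponent (weyl_group v) (rfl \<alpha>) (rfl \<beta>) \<in> {2, 3, 4, 6, \<infinity>}"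
proof -
  interpret G: group "weyl_group v" by (rule group_weyl)
  have T: "rfl \<alpha> \<otimes>\<^bsub>weyl_group v\<^esub> rfl \<beta> = T" by (simp add: weyl_group_simps T_def)
  have "T \<in> carrier (weyl_group v)"
    unfolding weyl_group_simps T_def by (rule W_compose[OF refl_W[OF AR(1)] refl_W[OF AR(2)]])
  then have ord: "T ^^ n = id \<longleftrightarrow> G.ord T dvd n" for n
    using G.pow_eq_id[of T n] unfolding weyl_pow weyl_group_simps by blast
  have "G.ord T \<noteq> 1" using ord[of 1] T_neq_id by simp
  have "0 \<le> a * b" using a b by simp
  have small: "4 \<le> x \<or> x = 0 \<or> x = 1 \<or> x = 2 \<or> x = 3" if "0 \<le> x" for x :: int
    using that by linarith
  from \<open>0 \<le> a * b\<close> consider "4 \<le> a * b" | m where "(a * b, m) \<in> {(0, 2), (1, 3), (2, 4), (3, 6 :: nat)}"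
    using small[of "a * b"] by blast
  then show ?thesis
  proof cases
    case 1
    then have "G.ord T = 0"
      using ord T_infinite_order by (metis dvd_refl gr0I)
    then show ?thesis unfolding coxeter_exponent_def T by simp
  next
    case 2
    \<comment> \<open>The exact order need not be computed: every divisor of these numbers other
      than 1 is again one of them.\<close>
    then have m: "G.ord T dvd m" "m \<in> {2, 3, 4, 6}" using T_finite_order ord by auto
    then have "G.ord T \<le> m" "0 < m" by (auto intro: dvd_imp_le)
    then have "G.ord T \<le> 6" "G.ord T \<noteq> 0" "G.ord T \<noteq> 5" using m by auto
    then have "G.ord T \<in> {2, 3, 4, 6}" using \<open>G.ord T \<noteq> 1\<close> by auto
    then show ?thesis unfolding coxeter_exponent_def T Let_def by (auto simp: numeral_eq_enat)
  qed
qed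

end

section \<open>From admissibility to sign coherence\<close>

lemma coherent_skeleton_admissible:
  assumes "component R" "admissible R" "v \<in> R"
  shows "coherent_skeleton v"
proof -
  obtain v\<^sub>0 where v0: "R = {v'. \<exists>\<theta>. arrow v\<^sub>0 \<theta> v'}" using assms(1) unfolding component_def by blast
  obtain \<theta> where \<theta>: "arrow v\<^sub>0 \<theta> v" using assms(3) v0 by blast
  then have valid: "valid_root_datum v" using arrow_valid by blast
  obtain K where K: "\<forall>v\<in>R. half_baked_quotient v (K v)"
    and iso: "\<forall>v\<in>R. \<forall>v'\<in>R. \<forall>\<theta>. arrow v \<theta> v' \<longrightarrow>
            (\<exists>\<phi>. quotient_isomorphism v (K v) v' (K v') \<phi> \<and>
                 (\<forall>h. \<phi> (cls (K v) (gen_h h)) = cls (K v') (gen_h (\<theta> h))))"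
    using assms(2) unfolding admissible_def by blast
  have sk: "u \<in> R" "arrow v id u" "valid_root_datum u" if "u \<in> skeleton v" for u
  proof -
    show "arrow v id u" using skeleton_arrow[OF that valid] .
    then show "u \<in> R" using arrow.arrow_compose[OF \<theta>] unfolding v0 by blast
    show "valid_root_datum u" using skeleton_valid[OF that valid] .
  qed
  have iso': "\<exists>\<phi>. half_baked_isomorphism u (K u) u' (K u') \<phi>"
    if u: "u \<in> skeleton v" and u': "u' \<in> skeleton v" for u u'
  proof -
    \<comment> \<open>Passing from \<open>u\<close> back to \<open>v\<close> and on to
      \<open>u'\<close> induces the identity, so the isomorphism provided by admissibility fixes the
      Cartan part.\<close>
    have "arrow u (id \<circ> inv_into UNIV id) u'"
      by (rule arrow.arrow_compose[OF arrow.arrow_inverse[OF sk(2)[OF u]] sk(2)[OF u']])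
    then have "arrow u id u'" by (simp add: inv_id)
    then obtain \<phi> where "quotient_isomorphism u (K u) u' (K u') \<phi>"
      "\<forall>h. \<phi> (cls (K u) (gen_h h)) = cls (K u') (gen_h (id h))"
      using iso[rule_format, OF sk(1)[OF u] sk(1)[OF u']] by blast
    then have "half_baked_isomorphism u (K u) u' (K u') \<phi>"
      using K sk u u' by unfold_locales auto
    then show ?thesis by blast
  qed
  show ?thesis
  proof
    show "valid_root_datum v" by fact
  next
    fix u u' x assume "u \<in> skeleton v" "u' \<in> skeleton v"
    then obtain \<phi> where "half_baked_isomorphism u (K u) u' (K u') \<phi>" using iso' by blast
    then show "\<exists>n. root_b u x = root_sum u' n \<and> ((\<forall>y. 0 \<le> n y) \<or> (\<forall>y. n y \<le> 0))"
      using half_baked_isomorphism.root_b_coherent by metis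
  next
    fix u u' x y assume "u \<in> skeleton v" "u' \<in> skeleton v" and eq: "root_b u x = root_b u' y"
    then obtain \<phi> where "half_baked_isomorphism u (K u) u' (K u') \<phi>" using iso' by blast
    from half_baked_isomorphism.coroot_proportional[OF this eq]
    show "\<exists>c. coroot_a u x = c *\<^sub>C coroot_a u' y" by blast
  qed
qed

theorem corollary5p2p4:
  fixes R\<^sub>0 :: "('x::finite, 'h::fin_dim_complex_vector) root_datum set"
    and v :: "('x, 'h) root_datum"
  assumes "component R\<^sub>0" and "indecomposable R\<^sub>0" and "admissible R\<^sub>0" and "v \<in> R\<^sub>0"
  shows "coxeter_system (weyl_group v) (root_reflection v ` principal_roots v) \<and>
    (\<forall>\<alpha>\<in>principal_roots v. \<forall>\<beta>\<in>principal_roots v. \<alpha> \<noteq> \<beta> \<longrightarrow>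
       coxeter_exponent (weyl_group v) (root_reflection v \<alpha>) (root_reflection v \<beta>) \<in> {2, 3, 4, 6, \<infinity>})"
proof -
  interpret coherent_skeleton v
    by (rule coherent_skeleton_admissible[OF assms(1,3,4)])
  show ?thesis
  proof (intro conjI ballI impI)
    show "coxeter_system (weyl_group v) (root_reflection v ` principal_roots v)"
      by (rule coxeter_system_weyl)
    fix \<alpha> \<beta> assume p: "\<alpha> \<in> principal_roots v" "\<beta> \<in> principal_roots v" "\<alpha> \<noteq> \<beta>"
    obtain a :: int where a: "0 \<le> a" "\<beta> (coroot v \<alpha>) = - of_int a" using p by (rule principal_pairing)
    obtain b :: int where b: "0 \<le> b" "\<alpha> (coroot v \<beta>) = - of_int b"
      using p(2,1) p(3)[symmetric] by (rule principal_pairing)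
    interpret principal_pair v \<alpha> \<beta> a b
      by unfold_locales (fact p a b)+
    show "coxeter_exponent (weyl_group v) (root_reflection v \<alpha>) (root_reflection v \<beta>) \<in> {2, 3, 4, 6, \<infinity>}"
      by (rule exponent)
  qed
qed

end
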